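(* Let $\mathbf{X}$ be an isotropic unimodal Lévy process on $\mathbb{R}^d$ with Lévy–Khintchine exponent $\psi\in\Pi^\infty_\ell$ for some $\ell\in\mathcal{R}^\infty_0$. Then \[ \lim_{x\to0,\ t\psi(|x|^{-1})\to 0}\frac{p(t,x)}{t|x|^{-d}\ell(|x|^{-1})}=\frac{\Gamma(d/2)}{2\pi^{d/2}}. \]
   Context: An isotropic unimodal Lévy process on $\mathbb{R}^d$ is a pure-jump Lévy process $\mathbf{X}=(X_t)_{t\ge0}$, $X_0=0$, with $\mathbb{E}e^{i\langle\xi,X_t\rangle}=e^{-t\psi(\xi)}$, $\psi(\xi)=\int_{\mathbb{R}^d}(1-\cos\langle\xi,x\rangle)\,\nu(\mathrm{d}x)$, where the Lévy measure $\nu$ has a radial, radially non-increasing density (also denoted $\nu$); then for each $t>0$ the law of $X_t$ restricted to $\mathbb{R}^d\setminus\{0\}$ has a radial, radially non-increasing density $p(t,x)$. Radial functions are written as functions of $|x|$, e.g. $\psi(r)$, $r\ge0$. A positive function $\ell$ on $[a,\infty)$ is slowly varying at infinity ($\ell\in\mathcal{R}^\infty_0$) if $\ell(\lambda x)/\ell(x)\to1$ as $x\to\infty$ for every $\lambda>0$. For such $\ell$, the de Haan class $\Pi^\infty_\ell$ consists of $f:[a,\infty)\to[0,\infty)$ with $\lim_{x\to\infty}(f(\lambda x)-f(x))/\ell(x)=\log\lambda$ for every $\lambda>0$. The joint limit means: for all sequences $t_n>0$, $x_n\to0$ with $t_n\psi(|x_n|^{-1})\to0$, the ratio converges to the given value.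 *)

theory Defs
  imports "HOL-Analysis.Analysis" "HOL-Probability.Probability"
begin

definition slowly_varying_at_top :: "(real \<Rightarrow> real) \<Rightarrow> bool" where
  "slowly_varying_at_top l \<longleftrightarrow>
     (\<exists>a. \<forall>x\<ge>a. l x > 0) \<and>
     (\<forall>c>0. ((\<lambda>x. l (c * x) / l x) \<longlongrightarrow> 1) at_top)"

definition de_Haan_class :: "(real \<Rightarrow> real) \<Rightarrow> (real \<Rightarrow> real) \<Rightarrow> bool" where
  "de_Haan_class l f \<longleftrightarrow>
     (\<exists>a. \<forall>x\<ge>a. f x \<ge> 0) \<and>
     (\<forall>c>0. ((\<lambda>x. (f (c * x) - f x) / l x) \<longlongrightarrow> ln c) at_top)"

definition radial_nonincreasing :: "('a::real_normed_vector \<Rightarrow> real) \<Rightarrow> bool" where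
  "radial_nonincreasing f \<longleftrightarrow>
     (\<forall>x y. x \<noteq> 0 \<longrightarrow> norm x \<le> norm y \<longrightarrow> f y \<le> f x)"

end

theory Submission
  imports Defs
begin

text \<open>
  Averaging the characteristic function of \<open>X\<^sub>t\<close> against a standard Gaussian shows that
  \<open>\<integral> (e\<^bsup>-a\<^sup>2|x|\<^sup>2/2r\<^sup>2\<^esup> - e\<^bsup>-b\<^sup>2|x|\<^sup>2/2r\<^sup>2\<^esup>) d\<mu>\<^sub>t(x)\<close> is the Gaussian mean of
  \<open>e\<^bsup>-t\<psi>(a|\<xi>|/r)\<^esup> - e\<^bsup>-t\<psi>(b|\<xi>|/r)\<^esup>\<close>. After division by \<open>t l(1/r)\<close> the integrand tends to
  \<open>ln (b/a)\<close> when \<open>t\<psi>(1/r) \<rightarrow> 0\<close>, and a Potter type bound for the increments of \<open>\<psi>\<close> dominates it.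
  By Frullani's formula the same limits are produced by the measure \<open>C|y|\<^bsup>-d\<^esup>dy\<close>, where \<open>1/C\<close> is the
  area of the unit sphere. Karamata's argument (Weierstrass approximation in the variable
  \<open>e\<^bsup>-|y|\<^sup>2/2\<^esup>\<close>) extends the convergence to test functions supported in thin annuli adjacent to
  the unit sphere, and there radial monotonicity of \<open>p(t, \<cdot>)\<close> turns it into pointwise convergence.
\<close>

section \<open>Potter bounds for de Haan increments\<close>

text \<open>The limit measure \<open>C |y|^(-d) dy\<close> is invariant under dilations and has
  infinite mass both near 0 and near infinity. A single Gaussian therefore has infinite integral
  against it; a difference of two Gaussians vanishes at 0 and decays at infinity, and under Fourier
  duality it produces exactly the increments of \<psi> that the de Haan condition controls. The main
  obstacle is the passage to the limit under the average over \<xi>: the hypothesis gives a limit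
  for each fixed factor only, while |\<xi>| ranges over all scales. One bound, valid at every scale
  and integrable for the Gaussian law in every dimension, has to be extracted from pointwise limits.
  Monotonicity of the density is used on one side at a time. An annulus just inside the sphere
  through \<open>x\<close> bounds \<open>p(t,x)\<close> from above, one just outside bounds it from
  below, and each costs only a power of its radius ratio, which tends to 1 as the annulus shrinks to
  the sphere.\<close>

text \<open>Baire's theorem replaces the measure-theoretic proof of the uniform convergence theorem.\<close>

lemma uniform_bound_on_interval_of_pointwise_tendsto:
  fixes F :: "real \<Rightarrow> real"
  assumes cont: "continuous_on UNIV F"
    and lim: "\<And>y. ((\<lambda>u. F (u + y) - F u) \<longlongrightarrow> 0) at_top"
  obtains \<delta> X where "\<delta> > 0" "\<And>u y. u \<ge> X \<Longrightarrow> 0 \<le> y \<Longrightarrow> y \<le> \<delta> \<Longrightarrow> \<bar>F (u + y) - F u\<bar> \<le> 2"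
proof -
  define E where "E k = {y. \<forall>u\<ge>real k. \<bar>F (u + y) - F u\<bar> \<le> 1}" for k :: nat
  have clE: "closed (E k)" for k
  proof -
    have "E k = (\<Inter>u\<in>{real k..}. {y. \<bar>F (u + y) - F u\<bar> \<le> 1})"
      by (auto simp: E_def)
    moreover have "closed {y. \<bar>F (u + y) - F u\<bar> \<le> 1}" for u
      by (intro closed_Collect_le continuous_intros continuous_on_compose2[OF cont]) auto
    ultimately show ?thesis by (metis (no_types, lifting) closed_INT)
  qed
  have UE: "(\<Union>k. E k) = UNIV"
  proof -
    have "\<exists>k. y \<in> E k" for y
    proof -
      have "eventually (\<lambda>u. dist (F (u + y) - F u) 0 < 1) at_top"
        by (rule tendstoD[OF lim]) simp
      then obtain N where N: "\<And>u. u \<ge> N \<Longrightarrow> \<bar>F (u + y) - F u\<bar> < 1"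
        by (auto simp: eventually_at_top_linorder)
      obtain k where "real k \<ge> N" using real_arch_simple by blast
      then show ?thesis using N unfolding E_def by (intro exI[of _ k]) (auto intro!: less_imp_le)
    qed
    then show ?thesis by auto
  qed
  have "\<exists>k. interior (E k) \<noteq> {}"
  proof (rule ccontr)
    assume "\<not> ?thesis"
    then have emp: "interior (E k) = {}" for k by auto
    have "UNIV \<subseteq> closure (\<Inter>(range (\<lambda>k. - E k)))"
    proof (rule Baire)
      show "openin (top_of_set UNIV) T \<and> UNIV \<subseteq> closure T" if "T \<in> range (\<lambda>k. - E k)" for T
        using that emp clE by (auto simp: open_openin[symmetric] closure_complement)
    qed auto
    moreover have "\<Inter>(range (\<lambda>k. - E k)) = {}" using UE by auto
    ultimately show False by simp
  qed
  then obtain k z where z: "z \<in> interior (E k)" by blast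
  then obtain e where e: "e > 0" "cball z e \<subseteq> E k"
    by (meson interior_subset open_interior open_contains_cball subset_trans)
  \<comment> \<open>Both \<open>z\<close> and \<open>z + y\<close> lie in \<open>E k\<close>, so the
    increment from \<open>u\<close> to \<open>u + y\<close> is a difference of two increments
    started at \<open>u - z\<close>, each at most 1. This is the origin of the bound 2 and of the
    threshold \<open>k + z\<close>.\<close>
  have "\<bar>F (u + y) - F u\<bar> \<le> 2" if "u \<ge> real k + z" "0 \<le> y" "y \<le> e" for u y
  proof -
    have "z \<in> E k" "z + y \<in> E k" using e that by (auto simp: dist_real_def)
    moreover have "u - z \<ge> real k" using that by simp
    ultimately have "\<bar>F ((u - z) + z) - F (u - z)\<bar> \<le> 1" "\<bar>F ((u - z) + (z + y)) - F (u - z)\<bar> \<le> 1"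
      unfolding E_def by blast+
    then show ?thesis by (simp add: algebra_simps)
  qed
  then show ?thesis using that e by blast
qed

text \<open>The integer part of \<open>y\<close> costs at most \<epsilon> per unit step, the
  fractional part a constant, because finitely many steps of the length given by the local bound
  cover [0,1]. For \<open>F = ln \<circ> K \<circ> exp\<close> this is Potter's bound on
  \<open>K z / K x\<close> by a multiple of \<open>(z / x)\<close> to the power \<epsilon>, in both
  directions.\<close>

lemma Potter_bound_additive:
  fixes F :: "real \<Rightarrow> real"
  assumes cont: "continuous_on UNIV F"
    and lim: "\<And>y. ((\<lambda>u. F (u + y) - F u) \<longlongrightarrow> 0) at_top"
    and "\<epsilon> > 0"
  obtains A X where "\<And>u y. u \<ge> X \<Longrightarrow> 0 \<le> y \<Longrightarrow> \<bar>F (u + y) - F u\<bar> \<le> A + \<epsilon> * y"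
proof -
  obtain \<delta> X1 where d: "\<delta> > 0"
    and X1: "\<And>u y. u \<ge> X1 \<Longrightarrow> 0 \<le> y \<Longrightarrow> y \<le> \<delta> \<Longrightarrow> \<bar>F (u + y) - F u\<bar> \<le> 2"
    using uniform_bound_on_interval_of_pointwise_tendsto[OF cont lim] by blast
  have step: "\<bar>F (u + y) - F u\<bar> \<le> 2 * real n" if "u \<ge> X1" "0 \<le> y" "y \<le> real n * \<delta>" for u y n
    using that
  proof (induction n arbitrary: u y)
    case (Suc n)
    show ?case
    proof (cases "y \<le> \<delta>")
      case True
      then show ?thesis using X1[of u y] Suc.prems by simp
    next
      case False
      have "\<bar>F ((u + \<delta>) + (y - \<delta>)) - F (u + \<delta>)\<bar> \<le> 2 * real n"
        using Suc.prems d False by (intro Suc.IH) (auto simp: algebra_simps)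
      moreover have "\<bar>F (u + \<delta>) - F u\<bar> \<le> 2" using X1 Suc.prems d by simp
      ultimately show ?thesis by simp
    qed
  qed simp
  obtain N where N: "1 \<le> real N * \<delta>"
    using d by (metis ex_less_of_nat_mult less_imp_le)
  have "eventually (\<lambda>u. dist (F (u + 1) - F u) 0 < \<epsilon>) at_top"
    by (rule tendstoD[OF lim]) fact
  then obtain X2 where X2: "\<And>u. u \<ge> X2 \<Longrightarrow> \<bar>F (u + 1) - F u\<bar> < \<epsilon>"
    by (auto simp: eventually_at_top_linorder)
  define X where "X = max X1 X2"
  have int: "\<bar>F (u + real n) - F u\<bar> \<le> \<epsilon> * real n" if "u \<ge> X" for u n
  proof (induction n)
    case (Suc n)
    have "\<bar>F (u + real n + 1) - F (u + real n)\<bar> < \<epsilon>" using that by (intro X2) (auto simp: X_def)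
    with Suc show ?case by (simp add: algebra_simps)
  qed simp
  have "\<bar>F (u + y) - F u\<bar> \<le> 2 * real N + \<epsilon> * y" if u: "u \<ge> X" and y: "0 \<le> y" for u y
  proof -
    define n where "n = nat \<lfloor>y\<rfloor>"
    have n: "real n \<le> y" "y \<le> real n + 1" using y unfolding n_def by linarith+
    have "\<bar>F ((u + real n) + (y - real n)) - F (u + real n)\<bar> \<le> 2 * real N"
      using u n N by (intro step) (auto simp: X_def)
    moreover have "\<bar>F (u + real n) - F u\<bar> \<le> \<epsilon> * real n" using int u by simp
    moreover have "\<epsilon> * real n \<le> \<epsilon> * y" using n \<open>\<epsilon> > 0\<close> by simp
    ultimately show ?thesis by simp
  qed
  then show ?thesis using that by blast
qed

text \<open>
  No regularity of \<open>l\<close> is assumed, so the Potter bound is applied to the continuous function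
  \<open>K x = \<psi> (c x) - \<psi> x\<close>, which is asymptotic to \<open>l x ln c\<close>.
\<close>

lemma de_Haan_increment_bound:
  fixes \<psi> l :: "real \<Rightarrow> real"
  assumes cont: "continuous_on {0..} \<psi>"
    and l: "slowly_varying_at_top l" and \<psi>: "de_Haan_class l \<psi>" and c: "c > 1"
  obtains C X where "X > 0" "C > 0"
    "\<And>x s. x \<ge> X \<Longrightarrow> s > 0 \<Longrightarrow> \<bar>\<psi> (c * (s * x)) - \<psi> (s * x)\<bar> \<le> C * (sqrt s + 1 / sqrt s) * l x"
proof -
  define K where "K x = \<psi> (c * x) - \<psi> x" for x
  have contK: "continuous_on {0..} K"
    unfolding K_def using c
    by (intro continuous_intros continuous_on_compose2[OF cont]) auto
  have Klim: "((\<lambda>x. K x / l x) \<longlongrightarrow> ln c) at_top"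
    using \<psi> c by (auto simp: de_Haan_class_def K_def)
  obtain a0 where a0: "\<And>x. x \<ge> a0 \<Longrightarrow> l x > 0"
    using l by (auto simp: slowly_varying_at_top_def)
  have lnc: "ln c > 0" using c by simp
  have "eventually (\<lambda>x. K x / l x > ln c / 2 \<and> K x / l x < 2 * ln c) at_top"
    using lnc by (intro eventually_conj order_tendstoD[OF Klim]) auto
  then obtain a1 where a1: "\<And>x. x \<ge> a1 \<Longrightarrow> K x / l x > ln c / 2 \<and> K x / l x < 2 * ln c"
    by (auto simp: eventually_at_top_linorder)
  \<comment> \<open>Beyond \<open>exp U\<close> the function \<open>K\<close> lies between
    \<open>l * ln c / 2\<close> and \<open>2 * l * ln c\<close>, hence is positive and has a
    logarithm. The entry 1 in the maximum keeps the argument of \<open>ln\<close> positive.\<close>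
  define U where "U = ln (max 1 (max a0 a1))"
  have expU: "exp U \<ge> a0" "exp U \<ge> a1" by (auto simp: U_def)
  have Kpos: "K x > 0" "K x \<le> 2 * ln c * l x" "l x > 0" if "x \<ge> exp U" for x
  proof -
    have "x \<ge> a0" "x \<ge> a1" using that expU by linarith+
    then have "l x > 0" "K x / l x > ln c / 2" "K x / l x < 2 * ln c" using a0 a1 by auto
    moreover from this have "K x / l x > 0" using lnc by linarith
    ultimately show "K x > 0" "K x \<le> 2 * ln c * l x" "l x > 0"
      by (auto simp: field_simps zero_less_divide_iff)
  qed
  \<comment> \<open>Freezing the argument below \<open>U\<close> makes \<open>F\<close> continuous
    on the whole line, as the Baire argument requires; its increments near infinity are
    unaffected.\<close>
  define F where "F u = ln (K (exp (max u U)))" for u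
  have contF: "continuous_on UNIV F"
    unfolding F_def
    by (intro continuous_on_ln continuous_on_compose2[OF contK] continuous_intros)
       (auto simp: less_imp_neq[OF Kpos(1), symmetric])
  have limF: "((\<lambda>u. F (u + y) - F u) \<longlongrightarrow> 0) at_top" for y
  proof -
    have e: "filterlim (\<lambda>u::real. exp u) at_top at_top" by (rule exp_at_top)
    have sh: "filterlim (\<lambda>x. exp y * x) at_top (at_top :: real filter)"
      by (rule filterlim_tendsto_pos_mult_at_top[OF tendsto_const _ filterlim_ident]) simp
    \<comment> \<open>\<open>K\<close> inherits slow variation from \<open>l\<close>: the quotient
      \<open>K (exp y * x) / K x\<close> factors into three quotients with limits
      \<open>ln c\<close>, 1 and \<open>1 / ln c\<close>.\<close>
    have "((\<lambda>x. K (exp y * x) / l (exp y * x)) \<longlongrightarrow> ln c) at_top"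
      by (rule filterlim_compose[OF Klim sh])
    moreover have "((\<lambda>x. l (exp y * x) / l x) \<longlongrightarrow> 1) at_top"
      using l by (auto simp: slowly_varying_at_top_def)
    ultimately have "((\<lambda>x. (K (exp y * x) / l (exp y * x)) * (l (exp y * x) / l x) / (K x / l x)) \<longlongrightarrow> ln c * 1 / ln c) at_top"
      using Klim lnc by (intro tendsto_intros) auto
    then have "((\<lambda>x. (K (exp y * x) / l (exp y * x)) * (l (exp y * x) / l x) / (K x / l x)) \<longlongrightarrow> 1) at_top"
      using lnc by simp
    from filterlim_compose[OF this e]
    have "((\<lambda>u. ln ((K (exp y * exp u) / l (exp y * exp u)) * (l (exp y * exp u) / l (exp u)) / (K (exp u) / l (exp u)))) \<longlongrightarrow> ln 1) at_top"
      by (intro tendsto_ln) auto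
    moreover have "eventually (\<lambda>u. ln ((K (exp y * exp u) / l (exp y * exp u)) * (l (exp y * exp u) / l (exp u)) / (K (exp u) / l (exp u))) = F (u + y) - F u) at_top"
      using eventually_ge_at_top[of "max U (U - y)"]
    proof eventually_elim
      case (elim u)
      have "exp u \<ge> exp U" "exp y * exp u \<ge> exp U" using elim by (auto simp flip: exp_add)
      note P = Kpos[OF this(1)] Kpos[OF this(2)]
      have "(K (exp y * exp u) / l (exp y * exp u)) * (l (exp y * exp u) / l (exp u)) / (K (exp u) / l (exp u)) = K (exp y * exp u) / K (exp u)"
        using P by (simp add: field_simps)
      moreover have "max u U = u" "max (u + y) U = u + y" using elim by auto
      ultimately show ?case
        unfolding F_def using P by (simp add: ln_div exp_add mult_ac)
    qed
    ultimately show ?thesis by (simp add: tendsto_cong)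
  qed
  \<comment> \<open>The exponent \<open>1/2\<close> is a choice: any value in (0,1) would keep the
    negative power of |\<xi>| integrable for the Gaussian law even in dimension one, and
    \<open>1/2\<close> gives square roots.\<close>
  obtain A X0 where A: "\<And>u y. u \<ge> X0 \<Longrightarrow> 0 \<le> y \<Longrightarrow> \<bar>F (u + y) - F u\<bar> \<le> A + 1/2 * y"
    using Potter_bound_additive[OF contF limF, of "1/2"] by (metis half_gt_zero zero_less_one)
  define X where "X = exp (max X0 U)"
  have X: "X > 0" "X \<ge> exp U" by (auto simp: X_def)
  have pot: "K z \<le> exp A * sqrt (z / x) * K x \<and> K x \<le> exp A * sqrt (z / x) * K z"
    if "x \<ge> X" "z \<ge> x" for x z
  proof -
    have pos: "x > 0" "z > 0" using that X by linarith+
    have "x \<ge> exp U" "z \<ge> exp U" using that X by linarith+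
    note P = Kpos(1)[OF this(1)] Kpos(1)[OF this(2)]
    have lx: "ln x \<ge> max X0 U" using that pos by (simp add: X_def ln_ge_iff del: max.bounded_iff)
    have lz: "ln z \<ge> ln x" using that pos by simp
    have "\<bar>F (ln x + (ln z - ln x)) - F (ln x)\<bar> \<le> A + 1/2 * (ln z - ln x)"
      using lx lz by (intro A) auto
    moreover have "F (ln z) = ln (K z)" "F (ln x) = ln (K x)"
      using lx order_trans[OF _ lz, of U] pos by (simp_all add: F_def max_absorb1)
    ultimately have *: "\<bar>ln (K z) - ln (K x)\<bar> \<le> A + ln (z / x) / 2"
      using pos by (simp add: ln_div)
    have ex: "exp (A + ln (z / x) / 2) = exp A * sqrt (z / x)"
      using pos by (simp add: exp_add flip: ln_sqrt)
    have "exp (ln (K z)) \<le> exp (A + ln (z / x) / 2 + ln (K x))"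
         "exp (ln (K x)) \<le> exp (A + ln (z / x) / 2 + ln (K z))"
      using * by (auto simp del: exp_ln)
    then show ?thesis unfolding exp_add ex[unfolded exp_add] using P by (simp add: ex[unfolded exp_add])
  qed
  have "compact (K ` {0..X})"
    by (intro compact_continuous_image continuous_on_subset[OF contK]) auto
  then obtain M where M: "M > 0" "\<And>x. 0 \<le> x \<Longrightarrow> x \<le> X \<Longrightarrow> \<bar>K x\<bar> \<le> M"
    by (metis atLeastAtMost_iff bounded_pos compact_imp_bounded image_eqI real_norm_def)
  \<comment> \<open>The entry \<open>exp A\<close> serves \<open>s * x \<ge> X\<close>, where
    Potter's bound compares \<open>K (s * x)\<close> with \<open>K x\<close> directly. The other
    entry serves \<open>s * x < X\<close>, where only the compactness bound \<open>M\<close> is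
    available.\<close>
  define C0 where "C0 = max (exp A) (M * exp A / K X)"
  have KX: "K X > 0" using Kpos X by simp
  have C0: "C0 > 0" by (simp add: C0_def less_max_iff_disj)
  have main: "\<bar>K (s * x)\<bar> \<le> C0 * (sqrt s + 1 / sqrt s) * K x" if x: "x \<ge> X" and s: "s > 0" for x s
  proof -
    have xpos: "x > 0" using x X by linarith
    have Kx: "K x > 0" using Kpos(1) x X by auto
    have up: "D * K x \<le> C0 * (sqrt s + 1 / sqrt s) * K x" if "D \<le> C0 * sqrt s \<or> D \<le> C0 * (1 / sqrt s)" for D
    proof -
      have "C0 * sqrt s \<ge> 0" "C0 * (1 / sqrt s) \<ge> 0" using C0 s by auto
      then have "D \<le> C0 * (sqrt s + 1 / sqrt s)" using that by (auto simp: distrib_left)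
      then show ?thesis using Kx by simp
    qed
    consider "s \<ge> 1" | "s < 1" "s * x \<ge> X" | "s * x < X" by linarith
    then show ?thesis
    proof cases
      case 1
      then have "s * x \<ge> x" using xpos by simp
      then have "K (s * x) \<le> exp A * sqrt s * K x" "K (s * x) > 0"
        using pot[of x "s * x"] x xpos by (auto intro!: Kpos(1) order_trans[OF X(2)] order_trans[OF x])
      moreover have "exp A * sqrt s * K x \<le> C0 * (sqrt s + 1 / sqrt s) * K x"
        using s by (intro up disjI1 mult_right_mono) (auto simp: C0_def)
      ultimately show ?thesis by simp
    next
      case 2
      then have "s * x \<le> x" using xpos by simp
      then have "K (s * x) \<le> exp A * sqrt (x / (s * x)) * K x" "K (s * x) > 0"
        using pot[of "s * x" x] 2 xpos by (auto intro!: Kpos(1) order_trans[OF X(2)])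
      moreover have "sqrt (x / (s * x)) = 1 / sqrt s" using xpos by (simp add: real_sqrt_divide)
      moreover have "exp A * (1 / sqrt s) * K x \<le> C0 * (sqrt s + 1 / sqrt s) * K x"
        using s by (intro up disjI2 mult_right_mono) (auto simp: C0_def)
      ultimately show ?thesis by simp
    next
      \<comment> \<open>Potter's bound between \<open>X\<close> and \<open>x\<close>, together with
        \<open>x / X < 1 / s\<close>, shows that \<open>K x\<close> is at least
        \<open>K X * exp (- A) * sqrt s\<close>. Hence the constant \<open>M\<close> is absorbed by
        a multiple of \<open>K x / sqrt s\<close>.\<close>
      case 3
      have "\<bar>K (s * x)\<bar> \<le> M" using 3 s xpos by (intro M) auto
      moreover have "K X \<le> exp A * sqrt (x / X) * K x" using pot[of X x] x by auto
      moreover have "sqrt (x / X) \<le> 1 / sqrt s"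
      proof -
        have "sqrt (x / X) \<le> sqrt (1 / s)" using 3 X s by (intro real_sqrt_le_mono) (simp add: field_simps)
        then show ?thesis by (simp add: real_sqrt_divide)
      qed
      ultimately have "K X \<le> exp A * (1 / sqrt s) * K x"
        by (smt (verit) Kx exp_gt_zero mult_left_mono mult_right_mono)
      then have "M * 1 \<le> M * (exp A * (1 / sqrt s) * K x / K X)"
        using KX M(1) by (intro mult_left_mono) (auto simp only: le_divide_eq_1_pos less_imp_le)
      also have "\<dots> = (M * exp A / K X * (1 / sqrt s)) * K x" by (simp add: mult_ac)
      also have "\<dots> \<le> C0 * (sqrt s + 1 / sqrt s) * K x"
        using s by (intro up disjI2 mult_right_mono) (auto simp: C0_def)
      finally show ?thesis using \<open>\<bar>K (s * x)\<bar> \<le> M\<close> by linarith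
    qed
  qed
  show ?thesis
  proof
    show "X > 0" by fact
    \<comment> \<open>The factor \<open>2 * ln c\<close> arises when \<open>K x\<close> is replaced
      by its upper bound \<open>2 * ln c * l x\<close>.\<close>
    show "C0 * (2 * ln c) > 0" using C0 lnc by simp
    fix x s :: real assume x: "x \<ge> X" and s: "s > 0"
    have "\<bar>K (s * x)\<bar> \<le> C0 * (sqrt s + 1 / sqrt s) * K x" by (rule main[OF x s])
    also have "\<dots> \<le> C0 * (sqrt s + 1 / sqrt s) * (2 * ln c * l x)"
      using Kpos(2)[of x] x X C0 s by (intro mult_left_mono) auto
    finally show "\<bar>\<psi> (c * (s * x)) - \<psi> (s * x)\<bar> \<le> C0 * (2 * ln c) * (sqrt s + 1 / sqrt s) * l x"
      by (simp add: K_def mult_ac)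
  qed
qed

section \<open>Radial integrals\<close>

text \<open>The volume \<open>V r^d\<close> of a ball has derivative \<open>d V r^(d-1)\<close>, so
  \<open>d V\<close>, the area of the unit sphere, appears as the constant. Half-lines form an
  intersection-stable generator on which both measures are finite, so comparing volumes of balls is
  enough.\<close>

lemma distr_norm_lborel:
  "distr lborel borel (norm :: 'a::euclidean_space \<Rightarrow> real) =
   density lborel (\<lambda>r. ennreal (real DIM('a) * unit_ball_vol (real DIM('a)) * r ^ (DIM('a) - 1)) * indicator {0..} r)"
  (is "?M = ?N")
proof (rule measure_eqI_generator_eq)
  let ?V = "unit_ball_vol (real DIM('a))"
  let ?E = "range (\<lambda>r::real. {..r})"
  have m: "(\<lambda>r::real. ennreal (real DIM('a) * ?V * r ^ (DIM('a) - 1)) * indicator {0..} r) \<in> borel_measurable lborel"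
    by measurable
  have M: "emeasure ?M {..r} = (if r < 0 then 0 else ennreal (?V * r ^ DIM('a)))" for r
  proof -
    have "norm -` {..r} = cball (0::'a) r" by auto
    then show ?thesis by (simp add: emeasure_distr emeasure_cball)
  qed
  have N: "emeasure ?N {..r} = (if r < 0 then 0 else ennreal (?V * r ^ DIM('a)))" for r
  proof -
    have "emeasure ?N {..r} = (\<integral>\<^sup>+x. ennreal (real DIM('a) * ?V * x ^ (DIM('a) - 1)) * indicator {0..r} x \<partial>lborel)"
      by (subst emeasure_density[OF m]) (auto intro!: nn_integral_cong split: split_indicator)
    also have "\<dots> = (if r < 0 then 0 else ennreal (?V * r ^ DIM('a)))"
    proof (cases "r < 0")
      case False
      have "(\<integral>\<^sup>+x. ennreal (real DIM('a) * ?V * x ^ (DIM('a) - 1)) * indicator {0..r} x \<partial>lborel) =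
            ennreal (?V * r ^ DIM('a) - ?V * 0 ^ DIM('a))"
        using False by (intro nn_integral_FTC_Icc) (auto intro!: derivative_eq_intros)
      then show ?thesis using False by simp
    qed auto
    finally show ?thesis .
  qed
  show "Int_stable ?E" by (auto simp: Int_stable_def intro!: exI[of _ "min _ _"])
  show "?E \<subseteq> Pow UNIV" by auto
  show "emeasure ?M X = emeasure ?N X" if "X \<in> ?E" for X using that M N by auto
  have "sets (borel :: real measure) = sigma_sets UNIV ?E" by (subst borel_eq_atMost) simp
  then show "sets ?M = sigma_sets UNIV ?E" "sets ?N = sigma_sets UNIV ?E" by simp_all
  show "range (\<lambda>n::nat. {..real n}) \<subseteq> ?E" by auto
  show "(\<Union>n::nat. {..real n}) = UNIV" using real_arch_simple by auto
  show "emeasure ?M {..real n} \<noteq> \<infinity>" for n by (simp add: M)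
qed

lemma nn_integral_radial:
  fixes f :: "real \<Rightarrow> ennreal"
  assumes [measurable]: "f \<in> borel_measurable borel"
  shows "(\<integral>\<^sup>+x. f (norm x) \<partial>(lborel :: 'a::euclidean_space measure)) =
    (\<integral>\<^sup>+r. ennreal (real DIM('a) * unit_ball_vol (real DIM('a)) * r ^ (DIM('a) - 1)) * indicator {0..} r * f r \<partial>lborel)"
proof -
  have "(\<integral>\<^sup>+x. f (norm x) \<partial>(lborel :: 'a measure)) = (\<integral>\<^sup>+r. f r \<partial>distr lborel borel (norm :: 'a \<Rightarrow> real))"
    by (simp add: nn_integral_distr)
  then show ?thesis by (simp add: distr_norm_lborel nn_integral_density)
qed

text \<open>The quotient is the integral of \<open>r / 2 * exp (- u * r\<^sup>2 / 2)\<close> over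
  \<open>u\<close> in [a,b]. After exchanging the integrals, the one in \<open>r\<close> equals
  \<open>1 / (2 * u)\<close>, and the logarithm appears as its primitive.\<close>

lemma nn_integral_Frullani_gaussian:
  fixes a b :: real
  assumes "0 < a" "a \<le> b"
  shows "(\<integral>\<^sup>+r. ennreal ((exp (- a * r\<^sup>2 / 2) - exp (- b * r\<^sup>2 / 2)) / r) * indicator {0..} r \<partial>lborel) = ennreal (ln (b / a) / 2)"
proof -
  have 1: "ennreal ((exp (- a * r\<^sup>2 / 2) - exp (- b * r\<^sup>2 / 2)) / r) * indicator {0..} r =
     (\<integral>\<^sup>+u. ennreal (r / 2 * exp (- u * r\<^sup>2 / 2)) * indicator {a..b} u * indicator {0..} r \<partial>lborel)" for r
  proof (cases "r > 0")
    case True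
    have "(\<integral>\<^sup>+u. ennreal (r / 2 * exp (- u * r\<^sup>2 / 2)) * indicator {a..b} u \<partial>lborel) =
       ennreal (- exp (- b * r\<^sup>2 / 2) / r - (- exp (- a * r\<^sup>2 / 2) / r))"
      using True assms
      by (intro nn_integral_FTC_Icc) (auto intro!: derivative_eq_intros simp: power2_eq_square)
    then show ?thesis using True by (simp add: diff_divide_distrib)
  next
    \<comment> \<open>At \<open>r = 0\<close> the quotient is 0 by the convention for division by
      zero, in agreement with the vanishing factor \<open>r / 2\<close> on the other side.\<close>
    case False
    then show ?thesis by (cases "r = 0") auto
  qed
  have 2: "(\<integral>\<^sup>+r. ennreal (r / 2 * exp (- u * r\<^sup>2 / 2)) * indicator {0..} r \<partial>lborel) = ennreal (1 / (2 * u))" if "u > 0" for u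
  proof -
    have "(\<integral>\<^sup>+r. ennreal (r / 2 * exp (- u * r\<^sup>2 / 2)) * indicator {0..} r \<partial>lborel) = ennreal (0 - (- exp (- u * 0\<^sup>2 / 2) / (2 * u)))"
    proof (rule nn_integral_FTC_atLeast)
      have "filterlim (\<lambda>x. u / 2 * x ^ 2) at_top at_top" using that
        by (intro filterlim_tendsto_pos_mult_at_top[OF tendsto_const] filterlim_pow_at_top filterlim_ident) auto
      then have "((\<lambda>x. exp (- (u / 2 * x ^ 2))) \<longlongrightarrow> 0) at_top"
        by (intro filterlim_compose[OF exp_at_bot]) (simp add: filterlim_uminus_at_bot)
      then have "((\<lambda>x. - exp (- (u / 2 * x ^ 2)) / (2 * u)) \<longlongrightarrow> - 0 / (2 * u)) at_top"
        using that by (intro tendsto_intros) auto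
      then show "((\<lambda>x. - exp (- u * x\<^sup>2 / 2) / (2 * u)) \<longlongrightarrow> 0) at_top" by simp
    qed (use that in \<open>auto intro!: derivative_eq_intros\<close>)
    then show ?thesis by simp
  qed
  have "(\<integral>\<^sup>+r. ennreal ((exp (- a * r\<^sup>2 / 2) - exp (- b * r\<^sup>2 / 2)) / r) * indicator {0..} r \<partial>lborel) =
     (\<integral>\<^sup>+r. \<integral>\<^sup>+u. ennreal (r / 2 * exp (- u * r\<^sup>2 / 2)) * indicator {a..b} u * indicator {0..} r \<partial>lborel \<partial>lborel)"
    unfolding 1 ..
  also have "\<dots> = (\<integral>\<^sup>+u. \<integral>\<^sup>+r. ennreal (r / 2 * exp (- u * r\<^sup>2 / 2)) * indicator {a..b} u * indicator {0..} r \<partial>lborel \<partial>lborel)"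
    by (rule lborel_pair.Fubini') measurable
  also have "\<dots> = (\<integral>\<^sup>+u. ennreal (1 / (2 * u)) * indicator {a..b} u \<partial>lborel)"
  proof (rule nn_integral_cong)
    fix u :: real
    show "(\<integral>\<^sup>+r. ennreal (r / 2 * exp (- u * r\<^sup>2 / 2)) * indicator {a..b} u * indicator {0..} r \<partial>lborel) = ennreal (1 / (2 * u)) * indicator {a..b} u"
      using 2[of u] assms by (cases "u \<in> {a..b}") auto
  qed
  also have "\<dots> = ennreal (ln b / 2 - ln a / 2)"
    using assms by (intro nn_integral_FTC_Icc) (auto intro!: derivative_eq_intros)
  also have "\<dots> = ennreal (ln (b / a) / 2)" using assms by (simp add: ln_div diff_divide_distrib)
  finally show ?thesis .
qed

text \<open>In polar coordinates \<open>|y|^(-d)\<close> reduces the Jacobian \<open>r^(d-1)\<close>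
  to \<open>1 / r\<close>, which leaves Frullani's integral. Here \<open>a\<close> and
  \<open>b\<close> multiply \<open>(norm y)\<^sup>2\<close>, so they are squares of scale factors;
  hence the \<open>1/2\<close> with the logarithm.\<close>

lemma has_bochner_integral_Frullani_radial:
  fixes a b :: real
  assumes "0 < a" "a \<le> b"
  shows "has_bochner_integral (lborel :: 'a::euclidean_space measure)
    (\<lambda>y. (exp (- a * (norm y)\<^sup>2 / 2) - exp (- b * (norm y)\<^sup>2 / 2)) * norm y powr - real DIM('a))
    (real DIM('a) * unit_ball_vol (real DIM('a)) * (ln (b / a) / 2))"
proof (rule has_bochner_integral_nn_integral)
  let ?S = "real DIM('a) * unit_ball_vol (real DIM('a))"
  have S: "?S \<ge> 0" by simp
  have ge: "exp (- a * r\<^sup>2 / 2) - exp (- b * r\<^sup>2 / 2) \<ge> 0" for r :: real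
    using assms by (simp add: mult_right_mono)
  show "AE y::'a in lborel. 0 \<le> (exp (- a * (norm y)\<^sup>2 / 2) - exp (- b * (norm y)\<^sup>2 / 2)) * norm y powr - real DIM('a)"
    using ge by (intro AE_I2 mult_nonneg_nonneg) auto
  show "0 \<le> ?S * (ln (b / a) / 2)" using assms by (intro mult_nonneg_nonneg) auto
  have "(\<integral>\<^sup>+y. ennreal ((exp (- a * (norm y)\<^sup>2 / 2) - exp (- b * (norm y)\<^sup>2 / 2)) * norm y powr - real DIM('a)) \<partial>(lborel :: 'a measure)) =
     (\<integral>\<^sup>+r. ennreal (?S * r ^ (DIM('a) - 1)) * indicator {0..} r * ennreal ((exp (- a * r\<^sup>2 / 2) - exp (- b * r\<^sup>2 / 2)) * r powr - real DIM('a)) \<partial>lborel)"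
    by (rule nn_integral_radial) measurable
  also have "\<dots> = (\<integral>\<^sup>+r. ennreal ?S * (ennreal ((exp (- a * r\<^sup>2 / 2) - exp (- b * r\<^sup>2 / 2)) / r) * indicator {0..} r) \<partial>lborel)"
  proof (rule nn_integral_cong)
    fix r :: real
    consider "r < 0" | "r = 0" | "r > 0" by linarith
    then show "ennreal (?S * r ^ (DIM('a) - 1)) * indicator {0..} r * ennreal ((exp (- a * r\<^sup>2 / 2) - exp (- b * r\<^sup>2 / 2)) * r powr - real DIM('a)) =
      ennreal ?S * (ennreal ((exp (- a * r\<^sup>2 / 2) - exp (- b * r\<^sup>2 / 2)) / r) * indicator {0..} r)"
    proof cases
      case 3
      have "r ^ (DIM('a) - 1) * r powr - real DIM('a) = 1 / r"
        using 3 by (simp add: powr_minus powr_realpow field_simps flip: power_Suc)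
      then have "?S * r ^ (DIM('a) - 1) * (D * r powr - real DIM('a)) = ?S * (D / r)" for D
        using 3 by (simp only: mult.assoc mult.left_commute[of _ D]) (simp add: mult_ac)
      then have "?S * r ^ (DIM('a) - 1) * ((exp (- a * r\<^sup>2 / 2) - exp (- b * r\<^sup>2 / 2)) * r powr - real DIM('a)) =
         ?S * ((exp (- a * r\<^sup>2 / 2) - exp (- b * r\<^sup>2 / 2)) / r)"
        by blast
      then show ?thesis using 3 S ge[of r]
        by (simp add: ennreal_mult[symmetric] del: ennreal_mult'')
    qed auto
  qed
  also have "\<dots> = ennreal ?S * ennreal (ln (b / a) / 2)"
    by (subst nn_integral_cmult) (simp_all only: nn_integral_Frullani_gaussian[OF assms], measurable)
  also have "\<dots> = ennreal (?S * (ln (b / a) / 2))" using S by (rule ennreal_mult'[symmetric])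
  finally show "(\<integral>\<^sup>+y. ennreal ((exp (- a * (norm y)\<^sup>2 / 2) - exp (- b * (norm y)\<^sup>2 / 2)) * norm y powr - real DIM('a)) \<partial>(lborel :: 'a measure)) = ennreal (?S * (ln (b / a) / 2))" .
qed measurable

section \<open>The standard Gaussian measure\<close>

text \<open>Encoding the law as the image of a product of one-dimensional normal laws, rather than
  by a density, makes its characteristic function a product and its coordinates standard
  normal.\<close>

definition std_gaussian :: "'a::euclidean_space measure" where
  "std_gaussian = distr (\<Pi>\<^sub>M b\<in>Basis. std_normal_distribution) borel (\<lambda>f. \<Sum>b\<in>Basis. f b *\<^sub>R b)"

lemma measurable_sum_basis [measurable]:
  "(\<lambda>f. \<Sum>b\<in>Basis. f b *\<^sub>R b) \<in> (\<Pi>\<^sub>M b\<in>(Basis::'a::euclidean_space set). std_normal_distribution) \<rightarrow>\<^sub>M borel"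
  by measurable

lemma sets_std_gaussian [simp, measurable_cong]: "sets std_gaussian = sets borel"
  by (simp add: std_gaussian_def)

lemma space_std_gaussian [simp]: "space std_gaussian = UNIV"
  by (simp add: std_gaussian_def)

lemma product_prob_space_std_normal: "product_prob_space (\<lambda>_. std_normal_distribution)"
  by (intro product_prob_spaceI prob_space_normal_density) simp

lemma prob_space_std_gaussian: "prob_space std_gaussian"
  unfolding std_gaussian_def
  by (intro prob_space.prob_space_distr prob_space_PiM prob_space_normal_density) auto

lemma char_std_gaussian:
  "(\<integral>\<xi>. cis (\<xi> \<bullet> y) \<partial>std_gaussian) = complex_of_real (exp (- (norm (y::'a::euclidean_space))\<^sup>2 / 2))"
proof -
  interpret product_prob_space "\<lambda>_::'a. std_normal_distribution" by (rule product_prob_space_std_normal)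
  have "(\<integral>\<xi>. cis (\<xi> \<bullet> y) \<partial>std_gaussian) = (\<integral>f. cis ((\<Sum>b\<in>Basis. f b *\<^sub>R b) \<bullet> y) \<partial>(\<Pi>\<^sub>M b\<in>(Basis::'a set). std_normal_distribution))"
    unfolding std_gaussian_def by (subst integral_distr) (auto intro!: measurable_compose[OF _ borel_measurable_continuous_onI] continuous_intros simp: cis_conv_exp)
  also have "\<dots> = (\<integral>f. (\<Prod>b\<in>Basis. iexp ((y \<bullet> b) * f b)) \<partial>(\<Pi>\<^sub>M b\<in>(Basis::'a set). std_normal_distribution))"
    by (intro Bochner_Integration.integral_cong refl)
       (simp add: cis_conv_exp inner_sum_right inner_commute[of _ y] sum_distrib_left mult_ac flip: exp_sum)
  also have "\<dots> = (\<Prod>b\<in>Basis. \<integral>x. iexp ((y \<bullet> b) * x) \<partial>std_normal_distribution)"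
    by (rule product_integral_prod) (auto intro!: finite_measure.integrable_const_bound[where B=1] prob_space.finite_measure prob_space_normal_density)
  also have "\<dots> = (\<Prod>b\<in>Basis. complex_of_real (exp (- ((y \<bullet> b)\<^sup>2) / 2)))"
    using char_std_normal_distribution by (simp add: char_def fun_eq_iff)
  also have "\<dots> = complex_of_real (exp (\<Sum>b\<in>Basis. - ((y \<bullet> b)\<^sup>2) / 2))"
    by (simp add: exp_sum)
  also have "(\<Sum>b\<in>Basis. - ((y \<bullet> b)\<^sup>2) / 2) = - (norm y)\<^sup>2 / 2"
    unfolding power2_norm_eq_inner by (subst euclidean_inner) (simp add: sum_divide_distrib sum_negf power2_eq_square)
  finally show ?thesis .
qed

lemma cos_std_gaussian:
  "(\<integral>\<xi>. cos (\<xi> \<bullet> y) \<partial>std_gaussian) = exp (- (norm (y::'a::euclidean_space))\<^sup>2 / 2)"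
proof -
  interpret G: prob_space "std_gaussian :: 'a measure" by (rule prob_space_std_gaussian)
  have "integrable std_gaussian (\<lambda>\<xi>. cis (\<xi> \<bullet> y))"
    by (rule G.integrable_const_bound[of _ 1])
       (auto simp: cis_conv_exp)
  from integral_Re[OF this] show ?thesis by (simp add: char_std_gaussian)
qed

lemma distr_std_gaussian_inner:
  fixes b :: "'a::euclidean_space"
  assumes "b \<in> Basis"
  shows "distr std_gaussian borel (\<lambda>\<xi>. \<xi> \<bullet> b) = std_normal_distribution"
proof -
  have "distr std_gaussian borel (\<lambda>\<xi>. \<xi> \<bullet> b) =
     distr (\<Pi>\<^sub>M b\<in>(Basis::'a set). std_normal_distribution) borel (\<lambda>f. f b)"
    unfolding std_gaussian_def using assms by (subst distr_distr) (auto intro!: distr_cong simp: comp_def)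
  also have "\<dots> = distr (\<Pi>\<^sub>M b\<in>(Basis::'a set). std_normal_distribution) std_normal_distribution (\<lambda>f. f b)"
    by (intro distr_cong) auto
  also have "\<dots> = std_normal_distribution"
    using assms by (intro distr_PiM_component prob_space_normal_density) auto
  finally show ?thesis .
qed

text \<open>One nonzero coordinate already excludes \<xi> = 0, where the dominating function
  \<open>1 / sqrt (norm \<xi>)\<close> and the pointwise limits are of no use.\<close>

lemma AE_std_gaussian_inner_nonzero:
  fixes b :: "'a::euclidean_space"
  assumes "b \<in> Basis"
  shows "AE \<xi> in std_gaussian. \<xi> \<bullet> b \<noteq> 0"
proof -
  have "AE x in std_normal_distribution. x \<noteq> 0"
    using AE_lborel_singleton[of "0::real"] by (subst AE_density) auto
  then have "AE x in distr std_gaussian borel (\<lambda>\<xi>. \<xi> \<bullet> b). x \<noteq> 0"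
    by (simp only: distr_std_gaussian_inner[OF assms])
  then show ?thesis by (subst (asm) AE_distr_iff) auto
qed

lemma integrable_std_gaussian_inner:
  fixes b :: "'a::euclidean_space" and f :: "real \<Rightarrow> real"
  assumes "b \<in> Basis" and f: "integrable std_normal_distribution f"
  shows "integrable std_gaussian (\<lambda>\<xi>. f (\<xi> \<bullet> b))"
proof -
  have "integrable (distr std_gaussian borel (\<lambda>\<xi>. \<xi> \<bullet> b)) f"
    using f by (simp only: distr_std_gaussian_inner[OF assms(1)])
  moreover have "f \<in> borel_measurable borel" using f by (auto dest: borel_measurable_integrable)
  ultimately show ?thesis by (subst (asm) integrable_distr_eq) auto
qed

text \<open>From \<open>(r - 1)\<^sup>2 \<ge> 0\<close> the Gaussian factor is at most
  \<open>exp (1/2) * exp (- r)\<close>, and what remains is Euler's integral for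
  \<open>Gamma (1/2)\<close>.\<close>

lemma integrable_std_normal_inverse_sqrt:
  "integrable std_normal_distribution (\<lambda>x. 1 / sqrt \<bar>x\<bar>)"
proof -
  let ?g = "\<lambda>r. (1 / sqrt r) * exp (- r\<^sup>2 / 2)"
  have "((\<lambda>t. t powr (1/2 - 1) / exp t) has_integral Gamma (1/2)) {0::real..}"
    by (rule Gamma_integral_real) simp
  from nn_integral_has_integral_lebesgue[OF _ this]
  have fin: "(\<integral>\<^sup>+t. ennreal (indicator {0..} t * (t powr (-1/2) / exp t)) \<partial>lborel) < \<infinity>"
    by simp
  have "(\<integral>\<^sup>+x. ennreal (?g (norm x)) \<partial>(lborel :: real measure)) =
     (\<integral>\<^sup>+r. ennreal (real DIM(real) * unit_ball_vol (real DIM(real)) * r ^ (DIM(real) - 1)) * indicator {0..} r * ennreal (?g r) \<partial>lborel)"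
    by (rule nn_integral_radial) measurable
  also have "\<dots> = (\<integral>\<^sup>+r. 2 * (indicator {0..} r * ennreal (?g r)) \<partial>lborel)"
    by (simp add: unit_ball_vol_1 mult.assoc)
  also have "\<dots> \<le> (\<integral>\<^sup>+r. (2 * ennreal (exp (1/2))) * ennreal (indicator {0..} r * (r powr (-1/2) / exp r)) \<partial>lborel)"
  proof (rule nn_integral_mono)
    fix r :: real
    show "2 * (indicator {0..} r * ennreal (?g r)) \<le> (2 * ennreal (exp (1/2))) * ennreal (indicator {0..} r * (r powr (-1/2) / exp r))"
    proof (cases "r > 0")
      case True
      have "- r\<^sup>2 / 2 \<le> 1/2 - r" using zero_le_power2[of "r - 1"] by (simp add: power2_eq_square algebra_simps)
      then have le: "exp (- r\<^sup>2 / 2) \<le> exp (1/2) * exp (- r)" by (simp flip: exp_add)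
      have "1 / sqrt r = r powr (-1/2)" using True by (simp add: powr_minus powr_half_sqrt field_simps)
      then have "?g r = r powr (-1/2) * exp (- r\<^sup>2 / 2)" by simp
      also have "\<dots> \<le> r powr (-1/2) * (exp (1/2) * exp (- r))" by (intro mult_left_mono le) simp
      also have "\<dots> = exp (1/2) * (r powr (-1/2) / exp r)" by (simp add: exp_minus field_simps)
      finally have "?g r \<le> exp (1/2) * (r powr (-1/2) / exp r)" .
      then show ?thesis using True by (auto simp: ennreal_mult[symmetric] mult.assoc intro!: mult_left_mono)
    next
      case False
      then show ?thesis by (cases "r = 0") auto
    qed
  qed
  also have "\<dots> < \<infinity>" using fin by (subst nn_integral_cmult) (auto simp: ennreal_mult_less_top)
  finally have *: "(\<integral>\<^sup>+x. ennreal (?g \<bar>x\<bar>) \<partial>(lborel :: real measure)) < \<infinity>" by simp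
  have "integrable lborel (\<lambda>x. ?g \<bar>x\<bar>)"
    using * by (intro integrableI_nonneg) auto
  then have "integrable lborel (\<lambda>x. 1 / sqrt (2 * pi) * ?g \<bar>x\<bar>)" by (rule integrable_mult_right)
  then show ?thesis
    by (subst integrable_density) (auto simp: std_normal_density_def mult_ac)
qed

text \<open>This function of \<xi> is the shape of the Potter bound, so it dominates the Gaussian
  averages. Since a coordinate is at most the norm, one coordinate controls the singularity at 0 in
  every dimension; second moments control the growth.\<close>

lemma integrable_std_gaussian_sqrt_norm:
  "integrable (std_gaussian :: 'a::euclidean_space measure) (\<lambda>\<xi>. sqrt (norm \<xi>) + 1 / sqrt (norm \<xi>))"
proof -
  interpret G: prob_space "std_gaussian :: 'a measure" by (rule prob_space_std_gaussian)
  obtain b :: 'a where b: "b \<in> Basis" using nonempty_Basis by blast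
  have "integrable std_normal_distribution (\<lambda>x. x\<^sup>2)"
    using integrable_std_normal_distribution_moment by blast
  then have 1: "integrable (std_gaussian :: 'a measure) (\<lambda>\<xi>. (\<xi> \<bullet> i)\<^sup>2)" if "i \<in> Basis" for i
    by (rule integrable_std_gaussian_inner[OF that])
  have 2: "integrable (std_gaussian :: 'a measure) (\<lambda>\<xi>. 1 / sqrt \<bar>\<xi> \<bullet> b\<bar>)"
    by (rule integrable_std_gaussian_inner[OF b integrable_std_normal_inverse_sqrt])
  have "integrable (std_gaussian :: 'a measure) (\<lambda>\<xi>. (1 + (\<Sum>i\<in>Basis. (\<xi> \<bullet> i)\<^sup>2)) + 1 / sqrt \<bar>\<xi> \<bullet> b\<bar>)"
    by (intro Bochner_Integration.integrable_add Bochner_Integration.integrable_sum 1 2) auto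
  then show ?thesis
  proof (rule Bochner_Integration.integrable_bound)
    show "AE \<xi>::'a in std_gaussian. norm (sqrt (norm \<xi>) + 1 / sqrt (norm \<xi>)) \<le> norm (1 + (\<Sum>i\<in>Basis. (\<xi> \<bullet> i)\<^sup>2) + 1 / sqrt \<bar>\<xi> \<bullet> b\<bar>)"
      using AE_std_gaussian_inner_nonzero[OF b]
    proof eventually_elim
      case (elim \<xi>)
      have "(\<Sum>i\<in>Basis. (\<xi> \<bullet> i)\<^sup>2) = (norm \<xi>)\<^sup>2"
        unfolding power2_norm_eq_inner by (subst euclidean_inner) (simp add: power2_eq_square)
      moreover have "sqrt (norm \<xi>) \<le> 1 + (norm \<xi>)\<^sup>2"
      proof (rule real_le_lsqrt)
        show "norm \<xi> \<le> (1 + (norm \<xi>)\<^sup>2)\<^sup>2"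
        proof -
          have "norm \<xi> \<le> 1 + (norm \<xi>)\<^sup>2"
            using zero_le_power2[of "norm \<xi> - 1"] by (simp add: power2_diff) (smt (verit) norm_ge_zero)
          also have "\<dots> \<le> (1 + (norm \<xi>)\<^sup>2)\<^sup>2" by (rule self_le_power) auto
          finally show ?thesis .
        qed
      qed auto
      moreover have "1 / sqrt (norm \<xi>) \<le> 1 / sqrt \<bar>\<xi> \<bullet> b\<bar>"
        using elim Basis_le_norm[OF b, of \<xi>] by (intro divide_left_mono mult_pos_pos) auto
      ultimately show ?case by simp
    qed
  qed measurable
qed

section \<open>Gaussian averages of the characteristic function\<close>

text \<open>The Gaussian is its own Fourier transform up to normalisation: integrating
  \<open>cos (\<xi> \<bullet> a x)\<close> over \<xi> gives
  \<open>exp (- a\<^sup>2 |x|\<^sup>2 / 2)\<close>, integrating it over \<open>x\<close> gives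
  \<phi>. Fubini's theorem equates the two orders.\<close>

lemma integral_gaussian_eq_exponent:
  fixes M :: "'a::euclidean_space measure" and \<phi> :: "real \<Rightarrow> real"
  assumes M: "prob_space M" and sets [measurable_cong]: "sets M = sets borel"
    and char: "\<And>\<xi>. (\<integral>x. cis (\<xi> \<bullet> x) \<partial>M) = complex_of_real (\<phi> (norm \<xi>))"
    and "a \<ge> 0"
  shows "(\<integral>x. exp (- a\<^sup>2 * (norm x)\<^sup>2 / 2) \<partial>M) = (\<integral>\<xi>. \<phi> (a * norm \<xi>) \<partial>(std_gaussian :: 'a measure))"
    and "integrable (std_gaussian :: 'a measure) (\<lambda>\<xi>. \<phi> (a * norm \<xi>))"
proof -
  interpret M: prob_space M by fact
  interpret G: prob_space "std_gaussian :: 'a measure" by (rule prob_space_std_gaussian)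
  interpret P: pair_prob_space M "std_gaussian :: 'a measure" ..
  have cos: "(\<integral>x. cos (\<xi> \<bullet> x) \<partial>M) = \<phi> (norm \<xi>)" for \<xi>
  proof -
    have "integrable M (\<lambda>x. cis (\<xi> \<bullet> x))"
      by (rule M.integrable_const_bound[of _ 1]) (auto simp: cis_conv_exp)
    from integral_Re[OF this] show ?thesis by (simp add: char)
  qed
  have int: "integrable (M \<Otimes>\<^sub>M std_gaussian) (\<lambda>(x, \<xi>). cos (\<xi> \<bullet> (a *\<^sub>R x)))"
    by (rule P.integrable_const_bound[of _ 1]) auto
  have \<phi>: "(\<integral>x. cos (\<xi> \<bullet> (a *\<^sub>R x)) \<partial>M) = \<phi> (a * norm \<xi>)" for \<xi>
    using cos[of "a *\<^sub>R \<xi>"] \<open>a \<ge> 0\<close> by simp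
  have "(\<integral>x. exp (- a\<^sup>2 * (norm x)\<^sup>2 / 2) \<partial>M) = (\<integral>x. (\<integral>\<xi>. cos (\<xi> \<bullet> (a *\<^sub>R x)) \<partial>(std_gaussian :: 'a measure)) \<partial>M)"
    by (subst cos_std_gaussian) (simp add: power_mult_distrib)
  also have "\<dots> = (\<integral>\<xi>. (\<integral>x. cos (\<xi> \<bullet> (a *\<^sub>R x)) \<partial>M) \<partial>(std_gaussian :: 'a measure))"
    by (rule P.Fubini_integral[OF int, symmetric])
  finally show "(\<integral>x. exp (- a\<^sup>2 * (norm x)\<^sup>2 / 2) \<partial>M) = (\<integral>\<xi>. \<phi> (a * norm \<xi>) \<partial>(std_gaussian :: 'a measure))"
    by (simp only: \<phi>)
  from P.integrable_snd[OF int] show "integrable (std_gaussian :: 'a measure) (\<lambda>\<xi>. \<phi> (a * norm \<xi>))"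
    by (simp only: \<phi>)
qed

text \<open>Both properties are read off one characteristic function along a fixed ray. It is
  continuous by dominated convergence and, being an exponential, never 0, so its logarithm is
  continuous; its modulus is at most 1, which gives the sign.\<close>

lemma continuous_char_exponent:
  fixes M :: "'a::euclidean_space measure" and \<psi> :: "real \<Rightarrow> real"
  assumes M: "prob_space M" and sets [measurable_cong]: "sets M = sets borel"
    and char: "\<And>\<xi>. (\<integral>x. cis (\<xi> \<bullet> x) \<partial>M) = complex_of_real (exp (- t * \<psi> (norm \<xi>)))"
    and t: "t > 0"
  shows "continuous_on {0..} \<psi>" and "r \<ge> 0 \<Longrightarrow> \<psi> r \<ge> 0"
proof -
  interpret M: prob_space M by fact
  obtain b :: 'a where b: "b \<in> Basis" using nonempty_Basis by blast
  have eq: "\<psi> r = - ln (Re (\<integral>x. cis ((r *\<^sub>R b) \<bullet> x) \<partial>M)) / t" if "r \<ge> 0" for r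
    using char[of "r *\<^sub>R b"] that b t by simp
  have "isCont (\<lambda>r. \<integral>x. cis ((r *\<^sub>R b) \<bullet> x) \<partial>M) r0" for r0
    unfolding continuous_at_sequentially comp_def
  proof safe
    fix X assume X: "X \<longlonglongrightarrow> r0"
    show "(\<lambda>n. \<integral>x. cis ((X n *\<^sub>R b) \<bullet> x) \<partial>M) \<longlonglongrightarrow> (\<integral>x. cis ((r0 *\<^sub>R b) \<bullet> x) \<partial>M)"
      unfolding cis_conv_exp
      by (rule integral_dominated_convergence[where w="\<lambda>_. 1"]) (auto intro!: tendsto_intros X)
  qed
  then have cont: "continuous_on {0..} (\<lambda>r. \<integral>x. cis ((r *\<^sub>R b) \<bullet> x) \<partial>M)"
    by (intro continuous_at_imp_continuous_on) auto
  have "continuous_on {0..} (\<lambda>r. - ln (Re (\<integral>x. cis ((r *\<^sub>R b) \<bullet> x) \<partial>M)) / t)"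
    using t by (intro continuous_intros cont) (auto simp only: char Re_complex_of_real exp_not_eq_zero)
  then show "continuous_on {0..} \<psi>"
    by (subst continuous_on_cong[OF refl eq]) auto
  show "\<psi> r \<ge> 0" if "r \<ge> 0"
  proof -
    have "norm (\<integral>x. cis ((r *\<^sub>R b) \<bullet> x) \<partial>M) \<le> (\<integral>x. norm (cis ((r *\<^sub>R b) \<bullet> x)) \<partial>M)" 
      by (rule integral_norm_bound)
    also have "\<dots> = 1" by (simp add: M.prob_space)
    finally have "exp (- t * \<psi> r) \<le> 1" using char[of "r *\<^sub>R b"] that b by simp
    then show ?thesis using t by (simp add: zero_le_mult_iff)
  qed
qed

section \<open>Increments of the characteristic function and their Gaussian averages\<close>

text \<open>Both estimates are \<open>1 + z \<le> exp z\<close>. They hold without any order between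
  \<open>A\<close> and \<open>B\<close>, so no monotonicity of \<psi> has to be established.\<close>

lemma exp_diff_bounds:
  fixes A B :: real
  shows "exp (- A) - exp (- B) \<le> exp (- A) * (B - A)" "exp (- B) * (B - A) \<le> exp (- A) - exp (- B)"
proof -
  have "exp (- A) * (1 + (A - B)) \<le> exp (- A) * exp (A - B)" by (intro mult_left_mono) auto
  then show "exp (- A) - exp (- B) \<le> exp (- A) * (B - A)"
    by (simp add: algebra_simps flip: exp_add)
  have "exp (- B) * (1 + (B - A)) \<le> exp (- B) * exp (B - A)" by (intro mult_left_mono) auto
  then show "exp (- B) * (B - A) \<le> exp (- A) - exp (- B)"
    by (simp add: algebra_simps flip: exp_add)
qed

lemma abs_exp_diff_le:
  fixes A B :: real
  assumes "A \<ge> 0" "B \<ge> 0"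
  shows "\<bar>exp (- A) - exp (- B)\<bar> \<le> \<bar>B - A\<bar>"
proof (cases "A \<le> B")
  case True
  have "exp (- A) - exp (- B) \<le> exp (- A) * (B - A)" by (rule exp_diff_bounds)
  also have "\<dots> \<le> 1 * (B - A)" using assms True by (intro mult_right_mono) auto
  finally show ?thesis using True by simp
next
  case False
  have "exp (- B) - exp (- A) \<le> exp (- B) * (A - B)" by (rule exp_diff_bounds)
  also have "\<dots> \<le> 1 * (A - B)" using assms False by (intro mult_right_mono) auto
  finally show ?thesis using False by simp
qed
text \<open>Once \<open>t * \<psi> (c * x)\<close> tends to 0 for every fixed \<open>c\<close>, the
  exponentials linearise: the difference is squeezed between the increment of
  \<open>t * \<psi>\<close> multiplied by factors that tend to 1.\<close>

lemma exponent_increment_tendsto: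
  fixes \<psi> l :: "real \<Rightarrow> real" and t x :: "nat \<Rightarrow> real"
  assumes nonneg: "\<And>r. r \<ge> 0 \<Longrightarrow> \<psi> r \<ge> 0"
    and l: "slowly_varying_at_top l" and \<psi>: "de_Haan_class l \<psi>"
    and t: "\<And>n. t n > 0" and x: "filterlim x at_top sequentially"
    and lim: "(\<lambda>n. t n * \<psi> (x n)) \<longlonglongrightarrow> 0"
    and pos: "\<alpha> > 0" "\<beta> > 0"
  shows "(\<lambda>n. (exp (- t n * \<psi> (\<alpha> * x n)) - exp (- t n * \<psi> (\<beta> * x n))) / (t n * l (x n))) \<longlonglongrightarrow> ln (\<beta> / \<alpha>)"
proof -
  have D: "(\<lambda>n. (\<psi> (c * x n) - \<psi> (x n)) / l (x n)) \<longlonglongrightarrow> ln c" if "c > 0" for c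
    using \<psi> that filterlim_compose[OF _ x] unfolding de_Haan_class_def by blast
  obtain a0 where a0: "\<And>x. x \<ge> a0 \<Longrightarrow> l x > 0"
    using l by (auto simp: slowly_varying_at_top_def)
  have lpos: "eventually (\<lambda>n. l (x n) > 0) sequentially"
    using x[unfolded filterlim_at_top, rule_format, of a0] by eventually_elim (rule a0)
  have xpos: "eventually (\<lambda>n. x n > 0) sequentially"
    using x by (simp add: filterlim_at_top_dense)
  \<comment> \<open>Nonnegativity of \<open>\<psi> (x / e)\<close> bounds \<open>l\<close> by \<open>2 \<psi>\<close>, so that \<open>t l(x) \<rightarrow> 0\<close>.\<close>
  have "eventually (\<lambda>n. (\<psi> (exp (-1) * x n) - \<psi> (x n)) / l (x n) < - 1/2) sequentially"
    by (rule order_tendstoD(2)[OF D]) auto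
  then have bnd: "eventually (\<lambda>n. l (x n) \<le> 2 * \<psi> (x n)) sequentially"
    using lpos xpos
  proof eventually_elim
    case (elim n)
    have "\<psi> (exp (-1) * x n) \<ge> 0" using elim by (intro nonneg) simp
    with elim show ?case by (simp add: field_simps)
  qed
  have tl: "(\<lambda>n. t n * l (x n)) \<longlonglongrightarrow> 0"
  proof (rule tendsto_sandwich)
    show "eventually (\<lambda>n. 0 \<le> t n * l (x n)) sequentially"
      using lpos by eventually_elim (use t in \<open>auto simp: less_imp_le\<close>)
    show "eventually (\<lambda>n. t n * l (x n) \<le> 2 * (t n * \<psi> (x n))) sequentially"
      using bnd
    proof eventually_elim
      case (elim n)
      from mult_left_mono[OF elim, of "t n"] t[of n] show ?case by simp
    qed
    show "(\<lambda>n. 2 * (t n * \<psi> (x n))) \<longlonglongrightarrow> 0" using tendsto_mult[OF tendsto_const lim, of 2] by simp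
  qed simp
  \<comment> \<open>Smallness spreads from \<open>x\<close> to every fixed multiple of it:
    \<open>\<psi> (c * x)\<close> is \<open>\<psi> (x)\<close> plus \<open>l x\<close> times a
    convergent quotient, and both \<open>t * \<psi> (x)\<close> and \<open>t * l x\<close> tend to
    0.\<close>
  have z: "(\<lambda>n. t n * \<psi> (c * x n)) \<longlonglongrightarrow> 0" if "c > 0" for c
  proof -
    have "(\<lambda>n. t n * \<psi> (x n) + (t n * l (x n)) * ((\<psi> (c * x n) - \<psi> (x n)) / l (x n))) \<longlonglongrightarrow> 0 + 0 * ln c"
      by (intro tendsto_intros lim tl D that)
    moreover have "eventually (\<lambda>n. t n * \<psi> (x n) + (t n * l (x n)) * ((\<psi> (c * x n) - \<psi> (x n)) / l (x n)) = t n * \<psi> (c * x n)) sequentially"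
      using lpos by eventually_elim (simp add: field_simps)
    ultimately show ?thesis by (simp add: tendsto_cong)
  qed
  have inc: "(\<lambda>n. (t n * \<psi> (\<beta> * x n) - t n * \<psi> (\<alpha> * x n)) / (t n * l (x n))) \<longlonglongrightarrow> ln (\<beta> / \<alpha>)"
  proof -
    have "(\<lambda>n. (\<psi> (\<beta> * x n) - \<psi> (x n)) / l (x n) - (\<psi> (\<alpha> * x n) - \<psi> (x n)) / l (x n)) \<longlonglongrightarrow> ln \<beta> - ln \<alpha>"
      by (intro tendsto_intros D pos)
    moreover have "(\<psi> (\<beta> * x n) - \<psi> (x n)) / l (x n) - (\<psi> (\<alpha> * x n) - \<psi> (x n)) / l (x n) =
       (t n * \<psi> (\<beta> * x n) - t n * \<psi> (\<alpha> * x n)) / (t n * l (x n))" for n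
      using t[of n] by (simp add: diff_divide_distrib[symmetric] right_diff_distrib[symmetric])
    ultimately show ?thesis using pos by (simp add: ln_div)
  qed
  have lim': "(\<lambda>n. exp (- (t n * \<psi> (c * x n))) * ((t n * \<psi> (\<beta> * x n) - t n * \<psi> (\<alpha> * x n)) / (t n * l (x n)))) \<longlonglongrightarrow> ln (\<beta> / \<alpha>)"
    if "c > 0" for c
    using tendsto_mult[OF tendsto_exp[OF tendsto_minus[OF z[OF that]]] inc] by simp
  show ?thesis
  proof (rule tendsto_sandwich[OF _ _ lim'[OF pos(2)] lim'[OF pos(1)]])
    show "eventually (\<lambda>n. exp (- (t n * \<psi> (\<beta> * x n))) * ((t n * \<psi> (\<beta> * x n) - t n * \<psi> (\<alpha> * x n)) / (t n * l (x n)))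
      \<le> (exp (- t n * \<psi> (\<alpha> * x n)) - exp (- t n * \<psi> (\<beta> * x n))) / (t n * l (x n))) sequentially"
      using lpos
    proof eventually_elim
      case (elim n)
      have "t n * l (x n) > 0" using elim t by simp
      from divide_right_mono[OF exp_diff_bounds(2) less_imp_le[OF this]]
      show ?case by simp
    qed
    show "eventually (\<lambda>n. (exp (- t n * \<psi> (\<alpha> * x n)) - exp (- t n * \<psi> (\<beta> * x n))) / (t n * l (x n))
      \<le> exp (- (t n * \<psi> (\<alpha> * x n))) * ((t n * \<psi> (\<beta> * x n) - t n * \<psi> (\<alpha> * x n)) / (t n * l (x n)))) sequentially"
      using lpos
    proof eventually_elim
      case (elim n)
      have "t n * l (x n) > 0" using elim t by simp
      from divide_right_mono[OF exp_diff_bounds(1) less_imp_le[OF this]]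
      show ?case by simp
    qed
  qed
qed

text \<open>For each nonzero \<xi> the scales \<open>a |\<xi>|\<close> and \<open>b |\<xi>|\<close>
  have ratio \<open>b / a\<close>, so the limit of the integrand does not depend on \<xi> and
  averaging over a probability measure leaves it unchanged. Dominated convergence justifies the
  exchange.\<close>

lemma gaussian_increment_tendsto:
  fixes \<mu> :: "real \<Rightarrow> 'a::euclidean_space measure" and \<psi> l :: "real \<Rightarrow> real" and t x :: "nat \<Rightarrow> real"
  assumes prob: "\<And>t. t > 0 \<Longrightarrow> prob_space (\<mu> t)"
    and sets: "\<And>t. t > 0 \<Longrightarrow> sets (\<mu> t) = sets borel"
    and char: "\<And>t \<xi>. t > 0 \<Longrightarrow> (\<integral>x. cis (\<xi> \<bullet> x) \<partial>(\<mu> t)) = complex_of_real (exp (- t * \<psi> (norm \<xi>)))"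
    and l: "slowly_varying_at_top l" and \<psi>: "de_Haan_class l \<psi>"
    and t: "\<And>n. t n > 0" and x: "filterlim x at_top sequentially"
    and lim: "(\<lambda>n. t n * \<psi> (x n)) \<longlonglongrightarrow> 0"
    and ab: "0 < a" "a < b"
  shows "(\<lambda>n. (\<integral>y. exp (- (a * x n)\<^sup>2 * (norm y)\<^sup>2 / 2) - exp (- (b * x n)\<^sup>2 * (norm y)\<^sup>2 / 2) \<partial>\<mu> (t n)) / (t n * l (x n)))
     \<longlonglongrightarrow> ln (b / a)"
proof -
  interpret G: prob_space "std_gaussian :: 'a measure" by (rule prob_space_std_gaussian)
  have cont: "continuous_on {0..} \<psi>" and nonneg: "\<And>r. r \<ge> 0 \<Longrightarrow> \<psi> r \<ge> 0"
    using continuous_char_exponent[OF prob sets char, of 1] by auto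
  define h where "h n \<xi> = (exp (- t n * \<psi> (a * x n * norm \<xi>)) - exp (- t n * \<psi> (b * x n * norm \<xi>))) / (t n * l (x n))"
    for n and \<xi> :: 'a
  have ba: "b / a > 1" using ab by simp
  obtain C X where X: "X > 0" and C: "C > 0"
    and CX: "\<And>x s. x \<ge> X \<Longrightarrow> s > 0 \<Longrightarrow> \<bar>\<psi> (b / a * (s * x)) - \<psi> (s * x)\<bar> \<le> C * (sqrt s + 1 / sqrt s) * l x"
    by (rule de_Haan_increment_bound[OF cont l \<psi> ba]) (rule that)
  obtain a0 where a0: "\<And>x. x \<ge> a0 \<Longrightarrow> l x > 0"
    using l by (auto simp: slowly_varying_at_top_def)
  \<comment> \<open>The Potter bound and the positivity of \<open>l\<close> hold for large arguments
    only. Shifting the sequence by \<open>N\<close> makes the domination valid at every index; the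
    shift is undone at the end.\<close>
  obtain N where N: "\<And>n. n \<ge> N \<Longrightarrow> x n \<ge> max a0 X"
    using x unfolding filterlim_at_top eventually_sequentially by blast
  obtain e :: 'a where e: "e \<in> Basis" using nonempty_Basis by blast
  have AE0: "AE \<xi>::'a in std_gaussian. \<xi> \<noteq> 0"
    using AE_std_gaussian_inner_nonzero[OF e] by eventually_elim auto
  have int: "integrable (std_gaussian :: 'a measure) (\<lambda>\<xi>. exp (- t n * \<psi> (c * x n * norm \<xi>)))"
    and eq: "(\<integral>y. exp (- (c * x n)\<^sup>2 * (norm y)\<^sup>2 / 2) \<partial>\<mu> (t n)) = (\<integral>\<xi>. exp (- t n * \<psi> (c * x n * norm \<xi>)) \<partial>(std_gaussian :: 'a measure))"
    if "c > 0" "x n \<ge> X" for c n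
    using integral_gaussian_eq_exponent[OF prob[OF t] sets[OF t] char[OF t], of "c * x n"] that X
    by auto
  have intM: "integrable (\<mu> (t n)) (\<lambda>y. exp (- (c * x n)\<^sup>2 * (norm y)\<^sup>2 / 2))" for c n
  proof -
    interpret M: prob_space "\<mu> (t n)" using prob t by simp
    note [measurable_cong] = sets[OF t[of n]]
    show ?thesis by (rule M.integrable_const_bound[of _ 1]) auto
  qed
  have "(\<lambda>n. \<integral>\<xi>. h (n + N) \<xi> \<partial>std_gaussian) \<longlonglongrightarrow> (\<integral>\<xi>. ln (b / a) \<partial>(std_gaussian :: 'a measure))"
  proof (rule integral_dominated_convergence)
    show "integrable (std_gaussian :: 'a measure) (\<lambda>\<xi>. C * (sqrt a + 1 / sqrt a) * (sqrt (norm \<xi>) + 1 / sqrt (norm \<xi>)))"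
      by (intro integrable_mult_right integrable_std_gaussian_sqrt_norm)
    show "h (n + N) \<in> borel_measurable std_gaussian" for n
      unfolding h_def using N[of "n + N"] ab
      by (intro borel_measurable_divide borel_measurable_diff borel_measurable_integrable[OF int]) auto
    show "AE \<xi> in std_gaussian. (\<lambda>n. h (n + N) \<xi>) \<longlonglongrightarrow> ln (b / a)"
      using AE0
    proof eventually_elim
      case (elim \<xi>)
      have "(\<lambda>n. h n \<xi>) \<longlonglongrightarrow> ln ((b * norm \<xi>) / (a * norm \<xi>))"
        using exponent_increment_tendsto[OF nonneg l \<psi> t x lim, of "a * norm \<xi>" "b * norm \<xi>"] elim ab
        by (simp add: h_def mult_ac)
      then show ?case using elim by (intro LIMSEQ_ignore_initial_segment) simp
    qed
    show "AE \<xi> in std_gaussian. norm (h (n + N) \<xi>) \<le> C * (sqrt a + 1 / sqrt a) * (sqrt (norm \<xi>) + 1 / sqrt (norm \<xi>))" for n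
      using AE0
    proof eventually_elim
      case (elim \<xi>)
      \<comment> \<open>With \<open>s = a |\<xi>|\<close> the two arguments of \<psi> are
        \<open>s * x m\<close> and \<open>b / a * (s * x m)\<close>, the form in which the increment
        bound is stated. The factors \<open>t m\<close> and \<open>l (x m)\<close> then cancel,
        leaving a bound independent of \<open>m\<close>.\<close>
      define m s where "m = n + N" and "s = a * norm \<xi>"
      have xm: "x m \<ge> X" "l (x m) > 0" "x m > 0" using N[of m] a0[of "x m"] X by (auto simp: m_def)
      have tl: "t m * l (x m) > 0" using xm t by simp
      have s: "s > 0" using elim ab by (simp add: s_def)
      have "\<bar>exp (- (t m * \<psi> (s * x m))) - exp (- (t m * \<psi> (b / a * (s * x m))))\<bar>
         \<le> \<bar>t m * \<psi> (b / a * (s * x m)) - t m * \<psi> (s * x m)\<bar>"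
        using s xm ab t[of m] by (intro abs_exp_diff_le mult_nonneg_nonneg nonneg) (auto simp: less_imp_le)
      also have "\<dots> = t m * \<bar>\<psi> (b / a * (s * x m)) - \<psi> (s * x m)\<bar>"
        using t[of m] by (simp add: abs_mult flip: right_diff_distrib)
      also have "\<dots> \<le> t m * (C * (sqrt s + 1 / sqrt s) * l (x m))"
        using CX[OF xm(1) s] t[of m] by (intro mult_left_mono) auto
      finally have "\<bar>exp (- (t m * \<psi> (s * x m))) - exp (- (t m * \<psi> (b / a * (s * x m))))\<bar> / (t m * l (x m)) \<le> C * (sqrt s + 1 / sqrt s)"
        using tl by (simp add: pos_divide_le_eq mult_ac)
      moreover have "h m \<xi> = (exp (- (t m * \<psi> (s * x m))) - exp (- (t m * \<psi> (b / a * (s * x m))))) / (t m * l (x m))"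
        using ab by (simp add: h_def s_def mult_ac)
      ultimately have "\<bar>h m \<xi>\<bar> \<le> C * (sqrt s + 1 / sqrt s)"
        using tl by simp
      also have "\<dots> \<le> C * ((sqrt a + 1 / sqrt a) * (sqrt (norm \<xi>) + 1 / sqrt (norm \<xi>)))"
      proof (intro mult_left_mono)
        show "sqrt s + 1 / sqrt s \<le> (sqrt a + 1 / sqrt a) * (sqrt (norm \<xi>) + 1 / sqrt (norm \<xi>))"
          using ab elim by (simp add: s_def real_sqrt_mult algebra_simps)
      qed (use C in simp)
      finally show ?case by (simp add: m_def mult.assoc)
    qed
  qed auto
  moreover have "(\<integral>\<xi>. h (n + N) \<xi> \<partial>std_gaussian) = (\<integral>y. exp (- (a * x (n + N))\<^sup>2 * (norm y)\<^sup>2 / 2) - exp (- (b * x (n + N))\<^sup>2 * (norm y)\<^sup>2 / 2) \<partial>\<mu> (t (n + N))) / (t (n + N) * l (x (n + N)))" for n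
  proof -
    have xm: "x (n + N) \<ge> X" using N[of "n + N"] by auto
    show ?thesis using ab xm
      by (simp only: h_def integral_divide_zero Bochner_Integration.integral_diff intM int eq less_trans[OF ab])
  qed
  ultimately have "(\<lambda>n. (\<integral>y. exp (- (a * x (n + N))\<^sup>2 * (norm y)\<^sup>2 / 2) - exp (- (b * x (n + N))\<^sup>2 * (norm y)\<^sup>2 / 2) \<partial>\<mu> (t (n + N))) / (t (n + N) * l (x (n + N)))) \<longlonglongrightarrow> ln (b / a)"
    using G.prob_space by simp
  then show ?thesis by (rule LIMSEQ_offset)
qed

section \<open>Karamata's argument\<close>

text \<open>A polynomial uniformly close to \<open>F\<close> on [0,1] has convergent integrals by
  linearity. The replacement error is controlled by the total masses, which converge by the moment
  \<open>k = 0\<close>. Keeping separate measures and functions \<open>W n\<close> avoids image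
  measures on [0,1]; since \<open>h n\<close> may be negative for small \<open>n\<close>, its sign
  is required only eventually.\<close>

lemma weighted_moments_tendsto:
  fixes M :: "nat \<Rightarrow> 'a measure" and N :: "'b measure"
    and W h :: "nat \<Rightarrow> 'a \<Rightarrow> real" and W' h' :: "'b \<Rightarrow> real" and F :: "real \<Rightarrow> real"
  assumes W [measurable]: "\<And>n. W n \<in> borel_measurable (M n)" and W01: "\<And>n x. W n x \<in> {0..1}"
    and h: "\<And>n. integrable (M n) (h n)" and h0: "eventually (\<lambda>n. \<forall>x. h n x \<ge> 0) sequentially"
    and W' [measurable]: "W' \<in> borel_measurable N" and W'01: "\<And>x. W' x \<in> {0..1}"
    and h': "integrable N h'" and h'0: "\<And>x. h' x \<ge> 0"
    and mom: "\<And>k. (\<lambda>n. \<integral>x. W n x ^ k * h n x \<partial>M n) \<longlonglongrightarrow> (\<integral>x. W' x ^ k * h' x \<partial>N)"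
    and F: "continuous_on UNIV F"
  shows "(\<lambda>n. \<integral>x. F (W n x) * h n x \<partial>M n) \<longlonglongrightarrow> (\<integral>x. F (W' x) * h' x \<partial>N)"
proof (rule metric_LIMSEQ_I)
  have intg: "integrable L (\<lambda>x. g (V x) * k x)"
    if g: "continuous_on UNIV g" and V: "V \<in> borel_measurable L" "\<And>x. V x \<in> {0..1}" and k: "integrable L k"
    for g :: "real \<Rightarrow> real" and L :: "'c measure" and V k
  proof -
    have "compact (g ` {0..1})" using g by (intro compact_continuous_image continuous_on_subset[OF g]) auto
    then obtain B where B: "\<And>u. u \<in> {0..1} \<Longrightarrow> \<bar>g u\<bar> \<le> B"
      by (metis bounded_iff compact_imp_bounded image_eqI real_norm_def)
    have [measurable]: "g \<in> borel_measurable borel" using g by (rule borel_measurable_continuous_onI)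
    note V(1)[measurable] borel_measurable_integrable[OF k, measurable]
    have "integrable L (\<lambda>x. B * k x)" using k by simp
    then show ?thesis
    proof (rule Bochner_Integration.integrable_bound)
      show "AE x in L. norm (g (V x) * k x) \<le> norm (B * k x)"
      proof (rule AE_I2)
        fix x
        have "\<bar>g (V x)\<bar> \<le> \<bar>B\<bar>" using B[OF V(2)[of x]] by linarith
        then show "norm (g (V x) * k x) \<le> norm (B * k x)" by (simp add: abs_mult mult_right_mono)
      qed
    qed measurable
  qed
  have close: "\<bar>(\<integral>x. F (V x) * k x \<partial>L) - (\<integral>x. g (V x) * k x \<partial>L)\<bar> \<le> \<epsilon> * (\<integral>x. k x \<partial>L)"
    if g: "continuous_on UNIV g" and V: "V \<in> borel_measurable L" "\<And>x. V x \<in> {0..1}"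
      and k: "integrable L k" "\<And>x. k x \<ge> 0" and e: "\<And>u. u \<in> {0..1} \<Longrightarrow> \<bar>F u - g u\<bar> \<le> \<epsilon>"
    for g :: "real \<Rightarrow> real" and L :: "'c measure" and V k \<epsilon>
  proof -
    have i: "integrable L (\<lambda>x. F (V x) * k x)" "integrable L (\<lambda>x. g (V x) * k x)"
      using intg[OF F V k(1)] intg[OF g V k(1)] .
    have "\<bar>(\<integral>x. F (V x) * k x \<partial>L) - (\<integral>x. g (V x) * k x \<partial>L)\<bar> = \<bar>\<integral>x. (F (V x) - g (V x)) * k x \<partial>L\<bar>"
      by (simp add: left_diff_distrib i)
    also have "\<dots> \<le> (\<integral>x. \<epsilon> * k x \<partial>L)"
    proof (rule integral_abs_bound[THEN order_trans], rule integral_mono)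
      have "integrable L (\<lambda>x. (F (V x) - g (V x)) * k x)" using i by (simp add: left_diff_distrib)
      then show "integrable L (\<lambda>x. \<bar>(F (V x) - g (V x)) * k x\<bar>)" by (rule integrable_abs)
      show "\<bar>(F (V x) - g (V x)) * k x\<bar> \<le> \<epsilon> * k x" for x
        using e[OF V(2)[of x]] k(2)[of x] by (simp add: abs_mult mult_right_mono)
    qed (use k in simp)
    finally show ?thesis by simp
  qed
  fix e :: real assume "e > 0"
  define H where "H = (\<integral>x. h' x \<partial>N)"
  have H: "H \<ge> 0" unfolding H_def using h'0 by simp
  \<comment> \<open>The three errors add up to \<epsilon> times \<open>(H + 1) + 1 + H\<close>: the
    mass at index \<open>n\<close>, the polynomial integrals, the limit mass. The remaining unit in
    \<open>2 * H + 3\<close> makes the final inequality strict.\<close>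
  define \<epsilon> where "\<epsilon> = e / (2 * H + 3)"
  have \<epsilon>: "\<epsilon> > 0" using \<open>e > 0\<close> H by (simp add: \<epsilon>_def)
  obtain g where g: "real_polynomial_function g" "\<And>u. u \<in> {0..1} \<Longrightarrow> \<bar>F u - g u\<bar> < \<epsilon>"
    using Stone_Weierstrass_real_polynomial_function[of "{0..1::real}" F \<epsilon>] \<epsilon> continuous_on_subset[OF F]
    by auto
  obtain a m where gsum: "g = (\<lambda>u. \<Sum>i\<le>m. a i * u ^ i)"
    using g(1) by (auto simp: real_polynomial_function_iff_sum)
  have contg: "continuous_on UNIV g" unfolding gsum by (intro continuous_intros)
  have gi: "(\<integral>x. g (V x) * k x \<partial>L) = (\<Sum>i\<le>m. a i * (\<integral>x. V x ^ i * k x \<partial>L))"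
    if V: "V \<in> borel_measurable L" "\<And>x. V x \<in> {0..1}" and k: "integrable L k" for L :: "'c measure" and V k
  proof -
    have "integrable L (\<lambda>x. V x ^ i * k x)" for i
      by (rule intg[OF _ V k]) (intro continuous_intros)
    then show ?thesis by (simp add: gsum sum_distrib_right mult.assoc)
  qed
  have "(\<lambda>n. \<integral>x. g (W n x) * h n x \<partial>M n) \<longlonglongrightarrow> (\<integral>x. g (W' x) * h' x \<partial>N)"
    unfolding gi[OF W W01 h] gi[OF W' W'01 h'] by (intro tendsto_intros mom)
  then have "eventually (\<lambda>n. \<bar>(\<integral>x. g (W n x) * h n x \<partial>M n) - (\<integral>x. g (W' x) * h' x \<partial>N)\<bar> < \<epsilon>) sequentially"
    using \<epsilon> by (auto simp: tendsto_iff dist_real_def)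
  moreover have "eventually (\<lambda>n. (\<integral>x. h n x \<partial>M n) < H + 1) sequentially"
    using order_tendstoD(2)[OF mom[of 0], of "H + 1"] by (simp add: H_def)
  ultimately have "eventually (\<lambda>n. dist (\<integral>x. F (W n x) * h n x \<partial>M n) (\<integral>x. F (W' x) * h' x \<partial>N) < e) sequentially"
    using h0
  proof eventually_elim
    case (elim n)
    have "\<bar>(\<integral>x. F (W n x) * h n x \<partial>M n) - (\<integral>x. g (W n x) * h n x \<partial>M n)\<bar> \<le> \<epsilon> * (\<integral>x. h n x \<partial>M n)"
      using elim(3) g(2) by (intro close contg W W01 h) (auto simp: less_imp_le)
    also have "\<dots> \<le> \<epsilon> * (H + 1)" using elim(2) \<epsilon> by (intro mult_left_mono) auto
    finally have 1: "\<bar>(\<integral>x. F (W n x) * h n x \<partial>M n) - (\<integral>x. g (W n x) * h n x \<partial>M n)\<bar> \<le> \<epsilon> * (H + 1)" .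
    have 2: "\<bar>(\<integral>x. F (W' x) * h' x \<partial>N) - (\<integral>x. g (W' x) * h' x \<partial>N)\<bar> \<le> \<epsilon> * H"
      unfolding H_def using h'0 g(2) by (intro close contg W' W'01 h') (auto simp: less_imp_le)
    have "dist (\<integral>x. F (W n x) * h n x \<partial>M n) (\<integral>x. F (W' x) * h' x \<partial>N) \<le> \<epsilon> * (H + 1) + \<epsilon> + \<epsilon> * H"
      using 1 2 elim(1) unfolding dist_real_def by linarith
    also have "\<dots> = \<epsilon> * (2 * H + 2)" by (simp add: algebra_simps)
    also have "\<dots> < \<epsilon> * (2 * H + 3)" using \<epsilon> by simp
    also have "\<dots> = e" using H by (simp add: \<epsilon>_def)
    finally show ?case .
  qed
  then show "\<exists>no. \<forall>n\<ge>no. dist (\<integral>x. F (W n x) * h n x \<partial>M n) (\<integral>x. F (W' x) * h' x \<partial>N) < e"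
    by (simp add: eventually_sequentially)
qed

text \<open>The weight \<open>w * (1 - w)\<close> makes the limit measure finite:
  \<open>1 - w\<close> is of order \<open>|y|^2\<close> at 0 and \<open>w\<close> decays at
  infinity. Its moment of order \<open>k\<close> is the integral of
  \<open>w^(k+1) - w^(k+2)\<close>, a difference of Gaussians with scale factors
  \<open>sqrt (k + 1)\<close> and \<open>sqrt (k + 2)\<close>.\<close>

lemma gaussian_test_tendsto:
  fixes \<mu> :: "real \<Rightarrow> 'a::euclidean_space measure" and \<psi> l F :: "real \<Rightarrow> real" and t x :: "nat \<Rightarrow> real"
  defines "w \<equiv> \<lambda>y::'a. exp (- (norm y)\<^sup>2 / 2)"
  assumes prob: "\<And>t. t > 0 \<Longrightarrow> prob_space (\<mu> t)"
    and sets: "\<And>t. t > 0 \<Longrightarrow> sets (\<mu> t) = sets borel"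
    and char: "\<And>t \<xi>. t > 0 \<Longrightarrow> (\<integral>x. cis (\<xi> \<bullet> x) \<partial>(\<mu> t)) = complex_of_real (exp (- t * \<psi> (norm \<xi>)))"
    and l: "slowly_varying_at_top l" and \<psi>: "de_Haan_class l \<psi>"
    and t: "\<And>n. t n > 0" and x: "filterlim x at_top sequentially"
    and lim: "(\<lambda>n. t n * \<psi> (x n)) \<longlonglongrightarrow> 0"
    and F: "continuous_on UNIV F"
  shows "(\<lambda>n. (\<integral>y. F (w (x n *\<^sub>R y)) * (w (x n *\<^sub>R y) * (1 - w (x n *\<^sub>R y))) \<partial>\<mu> (t n)) / (t n * l (x n)))
     \<longlonglongrightarrow> (\<integral>y. F (w y) * (w y * (1 - w y)) * norm y powr - real DIM('a) \<partial>lborel) / (real DIM('a) * unit_ball_vol (real DIM('a)))"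
proof -
  define S where "S = real DIM('a) * unit_ball_vol (real DIM('a))"
  have S: "S > 0" by (simp add: S_def)
  have [measurable]: "w \<in> borel_measurable borel" unfolding w_def by measurable
  have w01: "w y \<in> {0..1}" for y by (simp add: w_def)
  obtain a0 where a0: "\<And>x. x \<ge> a0 \<Longrightarrow> l x > 0"
    using l by (auto simp: slowly_varying_at_top_def)
  have lpos: "eventually (\<lambda>n. l (x n) > 0) sequentially"
    using x[unfolded filterlim_at_top, rule_format, of a0] by eventually_elim (rule a0)
  have wpow: "w y ^ k * (w y * (1 - w y)) = exp (- real (k + 1) * (norm y)\<^sup>2 / 2) - exp (- real (k + 2) * (norm y)\<^sup>2 / 2)" for y k
  proof -
    have "w y ^ k = exp (- real k * (norm y)\<^sup>2 / 2)" for k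
      by (simp add: w_def exp_of_nat_mult[symmetric])
    from this[of "k + 1"] this[of "k + 2"] show ?thesis by (simp add: algebra_simps)
  qed
  have Fru: "has_bochner_integral (lborel :: 'a measure) (\<lambda>y. w y ^ k * (w y * (1 - w y) * norm y powr - real DIM('a) / S)) (ln ((k + 2) / (k + 1)) / 2)" for k :: nat
  proof -
    have "has_bochner_integral (lborel :: 'a measure)
      (\<lambda>y. (exp (- real (k + 1) * (norm y)\<^sup>2 / 2) - exp (- real (k + 2) * (norm y)\<^sup>2 / 2)) * norm y powr - real DIM('a) / S)
      (S * (ln (real (k + 2) / real (k + 1)) / 2) / S)"
      unfolding S_def by (intro has_bochner_integral_divide has_bochner_integral_Frullani_radial) auto
    then show ?thesis using S unfolding wpow[symmetric] by (simp add: mult_ac)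
  qed
  have "(\<lambda>n. \<integral>y. F (w (x n *\<^sub>R y)) * (w (x n *\<^sub>R y) * (1 - w (x n *\<^sub>R y)) / (t n * l (x n))) \<partial>\<mu> (t n))
     \<longlonglongrightarrow> (\<integral>y. F (w y) * (w y * (1 - w y) * norm y powr - real DIM('a) / S) \<partial>lborel)"
  proof (rule weighted_moments_tendsto[OF _ _ _ _ _ _ _ _ _ F])
    fix n
    interpret M: prob_space "\<mu> (t n)" using prob t by simp
    note [measurable_cong] = sets[OF t[of n]]
    show "(\<lambda>y. w (x n *\<^sub>R y)) \<in> borel_measurable (\<mu> (t n))" by measurable
    have "integrable (\<mu> (t n)) (\<lambda>y. w (x n *\<^sub>R y) * (1 - w (x n *\<^sub>R y)))"
      using w01 by (intro M.integrable_const_bound[of _ 1]) (auto simp: abs_mult intro!: mult_le_one)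
    then show "integrable (\<mu> (t n)) (\<lambda>y. w (x n *\<^sub>R y) * (1 - w (x n *\<^sub>R y)) / (t n * l (x n)))" by simp
  next
    show "eventually (\<lambda>n. \<forall>y. 0 \<le> w (x n *\<^sub>R y) * (1 - w (x n *\<^sub>R y)) / (t n * l (x n))) sequentially"
      using lpos
    proof eventually_elim
      case (elim n)
      then show ?case using t[of n] w01 by auto
    qed
    show "integrable lborel (\<lambda>y. w y * (1 - w y) * norm y powr - real DIM('a) / S)"
      using Fru[of 0] by (auto dest: integrable.intros)
    show "0 \<le> w y * (1 - w y) * norm y powr - real DIM('a) / S" for y
      using w01[of y] S by auto
  next
    fix k :: nat
    have sq: "- (sqrt c * z)\<^sup>2 * (norm y)\<^sup>2 / 2 = - c * (norm (z *\<^sub>R y))\<^sup>2 / 2" if "c \<ge> 0" for c z and y :: 'a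
      using that by (simp add: power_mult_distrib)
    have "(\<lambda>n. (\<integral>y. exp (- (sqrt (real (k + 1)) * x n)\<^sup>2 * (norm y)\<^sup>2 / 2) - exp (- (sqrt (real (k + 2)) * x n)\<^sup>2 * (norm y)\<^sup>2 / 2) \<partial>\<mu> (t n)) / (t n * l (x n)))
     \<longlonglongrightarrow> ln (sqrt (real (k + 2)) / sqrt (real (k + 1)))"
      by (rule gaussian_increment_tendsto[OF prob sets char l \<psi> t x lim]) auto
    also have "ln (sqrt (real (k + 2)) / sqrt (real (k + 1))) = ln ((k + 2) / (k + 1)) / 2"
      by (simp add: ln_sqrt flip: real_sqrt_divide)
    also have "\<dots> = (\<integral>y. w y ^ k * (w y * (1 - w y) * norm y powr - real DIM('a) / S) \<partial>lborel)"
      by (rule has_bochner_integral_integral_eq[OF Fru, symmetric])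
    finally show "(\<lambda>n. \<integral>y. w (x n *\<^sub>R y) ^ k * (w (x n *\<^sub>R y) * (1 - w (x n *\<^sub>R y)) / (t n * l (x n))) \<partial>\<mu> (t n)) \<longlonglongrightarrow>
       (\<integral>y. w y ^ k * (w y * (1 - w y) * norm y powr - real DIM('a) / S) \<partial>lborel)"
      by (simp only: sq[OF of_nat_0_le_iff] wpow[symmetric] times_divide_eq_right integral_divide_zero)
  qed (use w01 in auto)
  then show ?thesis by (simp add: mult.assoc S_def)
qed

section \<open>Integrals against a radially non-increasing density\<close>

text \<open>Comparing two nonzero points of equal norm in both directions shows that
  \<open>p\<close> depends on the norm alone, and along a ray it is monotone, hence Borel. The
  origin is cut out because the order condition leaves the value there arbitrary.\<close>

lemma borel_measurable_radial_nonincreasing: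
  fixes p :: "'a::euclidean_space \<Rightarrow> real"
  assumes "radial_nonincreasing p"
  shows "(\<lambda>y. indicator (- {0}) y * p y) \<in> borel_measurable borel"
proof -
  obtain b :: 'a where b: "b \<in> Basis" using nonempty_Basis by blast
  define g where "g r = - p (r *\<^sub>R b)" for r
  have "mono_on {0<..} g"
    using assms b by (auto simp: mono_on_def radial_nonincreasing_def g_def nonzero_Basis)
  then have "g \<in> borel_measurable (restrict_space borel {0<..})" by (rule borel_measurable_mono_on_fnc)
  then have [measurable]: "(\<lambda>r. indicator {0<..} r *\<^sub>R g r) \<in> borel_measurable borel"
    by (subst (asm) borel_measurable_restrict_space_iff) auto
  have "p y = - g (norm y)" if "y \<noteq> 0" for y
  proof (rule antisym)
    show "p y \<le> - g (norm y)" "- g (norm y) \<le> p y"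
      using assms that b unfolding radial_nonincreasing_def g_def by (auto simp: nonzero_Basis)
  qed
  then have "(\<lambda>y. indicator (- {0}) y * p y) = (\<lambda>y. - (indicator {0<..} (norm y) *\<^sub>R g (norm y)))"
    by (auto split: split_indicator)
  also have "\<dots> \<in> borel_measurable borel" by measurable
  finally show ?thesis .
qed

text \<open>The measure may have an atom at 0, as for a compound Poisson process. Only test
  functions vanishing there are integrated through the density alone.\<close>

lemma nn_integral_density_off_zero:
  fixes M :: "'a::euclidean_space measure" and p :: "'a \<Rightarrow> real" and \<Phi> :: "'a \<Rightarrow> ennreal"
  assumes sets [measurable_cong]: "sets M = sets borel"
    and rad: "radial_nonincreasing p"
    and dens: "\<And>A. A \<in> sets borel \<Longrightarrow> emeasure M (A - {0}) = (\<integral>\<^sup>+ x \<in> A - {0}. ennreal (p x) \<partial>lborel)"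
    and \<Phi> [measurable]: "\<Phi> \<in> borel_measurable borel" and "\<Phi> 0 = 0"
  shows "(\<integral>\<^sup>+y. \<Phi> y \<partial>M) = (\<integral>\<^sup>+y. ennreal (p y) * \<Phi> y \<partial>lborel)"
proof -
  note borel_measurable_radial_nonincreasing[OF rad, measurable]
  have "density M (indicator (- {0})) = density lborel (\<lambda>y. ennreal (indicator (- {0}) y * p y))" (is "?L = ?R")
  proof (rule measure_eqI)
    fix A assume "A \<in> sets ?L"
    then have A [measurable]: "A \<in> sets borel" by (simp add: sets)
    have "emeasure ?L A = (\<integral>\<^sup>+y. indicator (A - {0}) y \<partial>M)"
      using A by (subst emeasure_density) (auto intro!: nn_integral_cong simp del: nn_integral_indicator split: split_indicator)
    also have "\<dots> = emeasure M (A - {0})" by (intro nn_integral_indicator) (simp add: sets)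
    also have "\<dots> = emeasure ?R A"
      unfolding dens[OF A]
      by (subst emeasure_density) (auto intro!: nn_integral_cong split: split_indicator)
    finally show "emeasure ?L A = emeasure ?R A" .
  qed (simp add: sets)
  then have "(\<integral>\<^sup>+y. \<Phi> y \<partial>?L) = (\<integral>\<^sup>+y. \<Phi> y \<partial>?R)" by simp
  also have "(\<integral>\<^sup>+y. \<Phi> y \<partial>?L) = (\<integral>\<^sup>+y. \<Phi> y \<partial>M)"
    using \<open>\<Phi> 0 = 0\<close> by (subst nn_integral_density) (auto intro!: nn_integral_cong split: split_indicator)
  also have "(\<integral>\<^sup>+y. \<Phi> y \<partial>?R) = (\<integral>\<^sup>+y. ennreal (p y) * \<Phi> y \<partial>lborel)"
    using \<open>\<Phi> 0 = 0\<close> by (subst nn_integral_density) (auto intro!: nn_integral_cong split: split_indicator)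
  finally show ?thesis .
qed

text \<open>This turns integrals into pointwise information: on the support of \<Phi> the density is
  at least \<open>p x0\<close> in the first case and at most \<open>p x0\<close> in the second. The
  condition \<open>\<Phi> 0 = 0\<close> avoids both a possible atom and the point where monotonicity
  says nothing.\<close>

lemma radial_density_integral_bounds:
  fixes M :: "'a::euclidean_space measure" and p \<Phi> :: "'a \<Rightarrow> real"
  assumes sets [measurable_cong]: "sets M = sets borel"
    and rad: "radial_nonincreasing p" and p0: "p x0 \<ge> 0" and x0: "x0 \<noteq> 0"
    and dens: "\<And>A. A \<in> sets borel \<Longrightarrow> emeasure M (A - {0}) = (\<integral>\<^sup>+ x \<in> A - {0}. ennreal (p x) \<partial>lborel)"
    and \<Phi>: "integrable lborel \<Phi>" "integrable M \<Phi>" "\<And>y. \<Phi> y \<ge> 0" "\<Phi> 0 = 0"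
  shows "(\<And>y. \<Phi> y \<noteq> 0 \<Longrightarrow> norm y \<le> norm x0) \<Longrightarrow> p x0 * (\<integral>y. \<Phi> y \<partial>lborel) \<le> (\<integral>y. \<Phi> y \<partial>M)"
    and "(\<And>y. \<Phi> y \<noteq> 0 \<Longrightarrow> norm x0 \<le> norm y) \<Longrightarrow> (\<integral>y. \<Phi> y \<partial>M) \<le> p x0 * (\<integral>y. \<Phi> y \<partial>lborel)"
proof -
  have [measurable]: "\<Phi> \<in> borel_measurable borel" using \<Phi>(1) by auto
  have M: "ennreal (\<integral>y. \<Phi> y \<partial>M) = (\<integral>\<^sup>+y. ennreal (p y) * ennreal (\<Phi> y) \<partial>lborel)"
    using \<Phi> by (subst nn_integral_eq_integral[symmetric]) (auto intro!: nn_integral_density_off_zero[OF sets rad dens])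
  have L: "ennreal (p x0 * (\<integral>y. \<Phi> y \<partial>lborel)) = (\<integral>\<^sup>+y. ennreal (p x0) * ennreal (\<Phi> y) \<partial>lborel)"
    using \<Phi> p0 by (subst nn_integral_cmult) (auto simp: nn_integral_eq_integral ennreal_mult')
  have nn: "(\<integral>y. \<Phi> y \<partial>M) \<ge> 0" "p x0 * (\<integral>y. \<Phi> y \<partial>lborel) \<ge> 0" using \<Phi> p0 by auto
  show "p x0 * (\<integral>y. \<Phi> y \<partial>lborel) \<le> (\<integral>y. \<Phi> y \<partial>M)" if s: "\<And>y. \<Phi> y \<noteq> 0 \<Longrightarrow> norm y \<le> norm x0"
  proof -
    have "ennreal (p x0 * (\<integral>y. \<Phi> y \<partial>lborel)) \<le> ennreal (\<integral>y. \<Phi> y \<partial>M)"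
      unfolding M L
    proof (rule nn_integral_mono)
      fix y
      have "p x0 \<le> p y" if "\<Phi> y \<noteq> 0"
        using s[OF that] rad \<Phi>(4) that unfolding radial_nonincreasing_def by metis
      then show "ennreal (p x0) * ennreal (\<Phi> y) \<le> ennreal (p y) * ennreal (\<Phi> y)"
        by (cases "\<Phi> y = 0") (auto intro!: mult_right_mono ennreal_leI)
    qed
    then show ?thesis using nn by simp
  qed
  show "(\<integral>y. \<Phi> y \<partial>M) \<le> p x0 * (\<integral>y. \<Phi> y \<partial>lborel)" if s: "\<And>y. \<Phi> y \<noteq> 0 \<Longrightarrow> norm x0 \<le> norm y"
  proof -
    have "ennreal (\<integral>y. \<Phi> y \<partial>M) \<le> ennreal (p x0 * (\<integral>y. \<Phi> y \<partial>lborel))"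
      unfolding M L
    proof (rule nn_integral_mono)
      fix y
      have "p y \<le> p x0" if "\<Phi> y \<noteq> 0"
        using s[OF that] rad x0 unfolding radial_nonincreasing_def by metis
      then show "ennreal (p y) * ennreal (\<Phi> y) \<le> ennreal (p x0) * ennreal (\<Phi> y)"
        by (cases "\<Phi> y = 0") (auto intro!: mult_right_mono ennreal_leI)
    qed
    then show ?thesis using nn by simp
  qed
qed

section \<open>Annular test functions and the limit\<close>

definition gauss_kernel :: "'a::real_normed_vector \<Rightarrow> real" where
  "gauss_kernel y = exp (- (norm y)\<^sup>2 / 2)"

text \<open>A tent in the variable \<open>u = gauss_kernel y\<close>, positive exactly for
  \<open>u\<close> between the kernel values at radii \<beta> and \<alpha>. The radii appear in
  reverse order because the kernel decreases in the norm.\<close>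

definition bump :: "real \<Rightarrow> real \<Rightarrow> real \<Rightarrow> real" where
  "bump \<alpha> \<beta> u = max 0 (min (u - exp (- \<beta>\<^sup>2 / 2)) (exp (- \<alpha>\<^sup>2 / 2) - u))"

text \<open>The factor \<open>gauss_kernel y * (1 - gauss_kernel y)\<close> is kept so that this is
  literally the integrand of \<open>gaussian_test_tendsto\<close> with
  \<open>F = bump \<alpha> \<beta>\<close>; it leaves the support in the annulus unchanged.\<close>

definition annulus_bump :: "real \<Rightarrow> real \<Rightarrow> 'a::real_normed_vector \<Rightarrow> real" where
  "annulus_bump \<alpha> \<beta> y = bump \<alpha> \<beta> (gauss_kernel y) * (gauss_kernel y * (1 - gauss_kernel y))"

lemma gauss_kernel_bounds: "gauss_kernel y > 0" "gauss_kernel y \<le> 1" "y \<noteq> 0 \<Longrightarrow> gauss_kernel y < 1"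
  by (auto simp: gauss_kernel_def)

lemma continuous_bump: "continuous_on UNIV (bump \<alpha> \<beta>)"
  unfolding bump_def by (intro continuous_intros)

lemma continuous_annulus_bump: "continuous_on UNIV (annulus_bump \<alpha> \<beta> :: 'a::real_normed_vector \<Rightarrow> real)"
  unfolding annulus_bump_def bump_def gauss_kernel_def by (intro continuous_intros) auto

lemma annulus_bump_nonneg: "annulus_bump \<alpha> \<beta> y \<ge> 0"
  using gauss_kernel_bounds[of y] by (auto simp: annulus_bump_def bump_def)

lemma annulus_bump_nonzero_iff:
  assumes "0 \<le> \<alpha>" "\<alpha> < \<beta>"
  shows "annulus_bump \<alpha> \<beta> y \<noteq> 0 \<longleftrightarrow> \<alpha> < norm y \<and> norm y < \<beta>"
proof -
  let ?u = "gauss_kernel y"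
  have lo: "?u > exp (- \<beta>\<^sup>2 / 2) \<longleftrightarrow> norm y < \<beta>" and hi: "?u < exp (- \<alpha>\<^sup>2 / 2) \<longleftrightarrow> \<alpha> < norm y"
    using assms by (auto simp: gauss_kernel_def power_strict_mono intro: power_less_imp_less_base)
  have "bump \<alpha> \<beta> ?u \<noteq> 0 \<longleftrightarrow> \<alpha> < norm y \<and> norm y < \<beta>"
    unfolding bump_def using lo hi by (auto simp: max_def min_def)
  moreover have "y \<noteq> 0" if "\<alpha> < norm y" using that assms by auto
  ultimately show ?thesis
    using gauss_kernel_bounds[of y] by (auto simp: annulus_bump_def)
qed

lemma annulus_bump_le_1: "annulus_bump \<alpha> \<beta> y \<le> 1"
proof -
  let ?u = "gauss_kernel y"
  have u: "0 \<le> ?u" "?u \<le> 1" using gauss_kernel_bounds[of y] by auto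
  have "exp (- \<beta>\<^sup>2 / 2) \<ge> 0" by simp
  with u have "bump \<alpha> \<beta> ?u \<le> 1" unfolding bump_def by linarith
  moreover have "bump \<alpha> \<beta> ?u \<ge> 0" by (simp add: bump_def)
  moreover have "?u * (1 - ?u) \<le> 1" "?u * (1 - ?u) \<ge> 0" using u by (auto intro!: mult_le_one)
  ultimately show ?thesis unfolding annulus_bump_def by (simp only: mult_le_one)
qed

lemma annulus_bump_measurable [measurable]: "(annulus_bump \<alpha> \<beta> :: 'a::euclidean_space \<Rightarrow> real) \<in> borel_measurable borel"
  by (intro borel_measurable_continuous_onI continuous_annulus_bump)

lemma integrable_annulus_bump:
  assumes "0 \<le> \<alpha>" "\<alpha> < \<beta>" "x > 0"
  shows "integrable lborel (\<lambda>y::'a::euclidean_space. annulus_bump \<alpha> \<beta> (x *\<^sub>R y))"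
proof -
  have "integrable lborel (\<lambda>y::'a. indicator (cball 0 (\<beta> / x)) y :: real)"
    using assms by (simp add: emeasure_cball less_top[symmetric])
  then show ?thesis
  proof (rule Bochner_Integration.integrable_bound)
    show "AE y::'a in lborel. norm (annulus_bump \<alpha> \<beta> (x *\<^sub>R y)) \<le> norm (indicator (cball 0 (\<beta> / x)) y :: real)"
    proof (rule AE_I2)
      fix y :: 'a
      have "norm y \<le> \<beta> / x" if "annulus_bump \<alpha> \<beta> (x *\<^sub>R y) \<noteq> 0"
        using that assms by (simp add: annulus_bump_nonzero_iff field_simps)
      then show "norm (annulus_bump \<alpha> \<beta> (x *\<^sub>R y)) \<le> norm (indicator (cball 0 (\<beta> / x)) y :: real)"
        using annulus_bump_nonneg[of \<alpha> \<beta> "x *\<^sub>R y"] annulus_bump_le_1[of \<alpha> \<beta> "x *\<^sub>R y"]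
        by (auto split: split_indicator)
    qed
  qed measurable
qed

lemma integral_annulus_bump_scale:
  assumes "x > 0"
  shows "(\<integral>y. annulus_bump \<alpha> \<beta> (x *\<^sub>R y) \<partial>(lborel :: 'a::euclidean_space measure)) =
    (1 / x) ^ DIM('a) * (\<integral>y. annulus_bump \<alpha> \<beta> y \<partial>(lborel :: 'a measure))"
proof -
  have "(\<integral>y. annulus_bump \<alpha> \<beta> (x *\<^sub>R y) \<partial>(lborel :: 'a measure)) =
     (\<integral>y. annulus_bump \<alpha> \<beta> (x *\<^sub>R y) \<partial>(density (distr lborel borel (\<lambda>y. 0 + (1 / x) *\<^sub>R y)) (\<lambda>_. \<bar>1 / x\<bar> ^ DIM('a)) :: 'a measure))"
    using assms by (subst lborel_affine[of "1 / x" "0::'a"]) auto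
  also have "\<dots> = (1 / x) ^ DIM('a) * (\<integral>y. annulus_bump \<alpha> \<beta> y \<partial>(lborel :: 'a measure))"
    using assms by (simp add: integral_density integral_distr)
  finally show ?thesis .
qed

lemma integral_annulus_bump_pos:
  assumes "0 \<le> \<alpha>" "\<alpha> < \<beta>"
  shows "(\<integral>y. annulus_bump \<alpha> \<beta> y \<partial>(lborel :: 'a::euclidean_space measure)) > 0"
proof -
  have int: "integrable (lborel :: 'a measure) (annulus_bump \<alpha> \<beta>)"
    using integrable_annulus_bump[OF assms, of 1] by simp
  define A :: "'a set" where "A = {y. \<alpha> < norm y \<and> norm y < \<beta>}"
  obtain b :: 'a where b: "b \<in> Basis" using nonempty_Basis by blast
  have "open A" unfolding A_def by (intro open_Collect_conj open_Collect_less continuous_intros)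
  moreover have "((\<alpha> + \<beta>) / 2) *\<^sub>R b \<in> A" using assms b by (simp add: A_def)
  ultimately have "\<not> negligible A" using open_not_negligible by blast
  have "(\<integral>y. annulus_bump \<alpha> \<beta> y \<partial>(lborel :: 'a measure)) \<noteq> 0"
  proof
    assume "(\<integral>y. annulus_bump \<alpha> \<beta> y \<partial>(lborel :: 'a measure)) = 0"
    then have "AE y::'a in lborel. annulus_bump \<alpha> \<beta> y = 0"
      using int by (subst (asm) integral_nonneg_eq_0_iff_AE) (auto simp: annulus_bump_nonneg)
    then have "AE y in lborel. y \<notin> A" by eventually_elim (use annulus_bump_nonzero_iff[OF assms] in \<open>auto simp: A_def\<close>)
    then have "A \<in> null_sets lborel" using \<open>open A\<close> by (subst (asm) AE_iff_null_sets[symmetric]) auto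
    then show False using \<open>\<not> negligible A\<close> by (simp add: negligible_iff_null_sets null_sets_completionI)
  qed
  moreover have "(\<integral>y. annulus_bump \<alpha> \<beta> y \<partial>(lborel :: 'a measure)) \<ge> 0"
    by (simp add: annulus_bump_nonneg)
  ultimately show ?thesis by linarith
qed

text \<open>On the annulus \<open>|y|^(-d)\<close> lies between its values at the two radii. The
  limit of the test integrals is thereby compared with the plain Lebesgue integral \<open>I\<close>,
  which later cancels.\<close>

lemma integral_annulus_bump_powr_bounds:
  fixes \<alpha> \<beta> :: real
  assumes "0 < \<alpha>" "\<alpha> < \<beta>"
  defines "J \<equiv> (\<integral>y. annulus_bump \<alpha> \<beta> y * norm y powr - real DIM('a) \<partial>(lborel :: 'a::euclidean_space measure))"
    and "I \<equiv> (\<integral>y. annulus_bump \<alpha> \<beta> y \<partial>(lborel :: 'a measure))"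
  shows "\<beta> powr - real DIM('a) * I \<le> J" "J \<le> \<alpha> powr - real DIM('a) * I"
proof -
  have int: "integrable (lborel :: 'a measure) (annulus_bump \<alpha> \<beta>)"
    using integrable_annulus_bump[of \<alpha> \<beta> 1] assms by simp
  have b: "annulus_bump \<alpha> \<beta> y * norm y powr - real DIM('a) \<le> \<alpha> powr - real DIM('a) * annulus_bump \<alpha> \<beta> y"
    "\<beta> powr - real DIM('a) * annulus_bump \<alpha> \<beta> y \<le> annulus_bump \<alpha> \<beta> y * norm y powr - real DIM('a)" for y :: 'a
  proof -
    have "norm y powr - real DIM('a) \<le> \<alpha> powr - real DIM('a)" "\<beta> powr - real DIM('a) \<le> norm y powr - real DIM('a)"
      if "annulus_bump \<alpha> \<beta> y \<noteq> 0"
      using that assms(1,2) by (auto simp: annulus_bump_nonzero_iff intro!: powr_mono2')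
    then show "annulus_bump \<alpha> \<beta> y * norm y powr - real DIM('a) \<le> \<alpha> powr - real DIM('a) * annulus_bump \<alpha> \<beta> y"
      "\<beta> powr - real DIM('a) * annulus_bump \<alpha> \<beta> y \<le> annulus_bump \<alpha> \<beta> y * norm y powr - real DIM('a)"
      using annulus_bump_nonneg[of \<alpha> \<beta> y]
      by (cases "annulus_bump \<alpha> \<beta> y = 0"; simp add: mult.commute mult_left_mono)+
  qed
  have int': "integrable (lborel :: 'a measure) (\<lambda>y. annulus_bump \<alpha> \<beta> y * norm y powr - real DIM('a))"
  proof (rule Bochner_Integration.integrable_bound)
    show "integrable (lborel :: 'a measure) (\<lambda>y. \<alpha> powr - real DIM('a) * annulus_bump \<alpha> \<beta> y)" using int by simp
    show "AE y::'a in lborel. norm (annulus_bump \<alpha> \<beta> y * norm y powr - real DIM('a)) \<le> norm (\<alpha> powr - real DIM('a) * annulus_bump \<alpha> \<beta> y)"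
      using b(1) by (intro AE_I2) (simp add: annulus_bump_nonneg)
  qed measurable
  have "(\<integral>y. \<beta> powr - real DIM('a) * annulus_bump \<alpha> \<beta> y \<partial>(lborel :: 'a measure)) \<le> J"
    "J \<le> (\<integral>y. \<alpha> powr - real DIM('a) * annulus_bump \<alpha> \<beta> y \<partial>(lborel :: 'a measure))"
    unfolding J_def by (intro integral_mono integrable_mult_right int int' b)+
  then show "\<beta> powr - real DIM('a) * I \<le> J" "J \<le> \<alpha> powr - real DIM('a) * I"
    by (simp_all add: I_def)
qed

section \<open>The density squeezed between annular averages\<close>

theorem mainTheorem2:
  fixes \<nu> :: "'a::euclidean_space \<Rightarrow> real"
    and \<mu> :: "real \<Rightarrow> 'a measure"
    and p :: "real \<Rightarrow> 'a \<Rightarrow> real"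
    and \<Psi> :: "real \<Rightarrow> real"
    and l :: "real \<Rightarrow> real"
  assumes nu_nonneg: "\<And>x. x \<noteq> 0 \<Longrightarrow> \<nu> x \<ge> 0"
    and nu_radial: "radial_nonincreasing \<nu>"
    and nu_levy: "(\<integral>\<^sup>+ x. ennreal (min 1 ((norm x)\<^sup>2) * \<nu> x) \<partial>lborel) < \<infinity>"
    and psi_def: "\<And>\<xi>. \<Psi> (norm \<xi>) = (\<integral> x. (1 - cos (\<xi> \<bullet> x)) * \<nu> x \<partial>lborel)"
    and mu_prob: "\<And>t. t > 0 \<Longrightarrow> prob_space (\<mu> t)"
    and mu_sets: "\<And>t. t > 0 \<Longrightarrow> sets (\<mu> t) = sets borel"
    and mu_char: "\<And>t \<xi>. t > 0 \<Longrightarrow>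
        (\<integral> x. cis (\<xi> \<bullet> x) \<partial>(\<mu> t)) = complex_of_real (exp (- t * \<Psi> (norm \<xi>)))"
    and p_nonneg: "\<And>t x. t > 0 \<Longrightarrow> x \<noteq> 0 \<Longrightarrow> p t x \<ge> 0"
    and p_density: "\<And>t A. t > 0 \<Longrightarrow> A \<in> sets borel \<Longrightarrow>
        emeasure (\<mu> t) (A - {0}) = (\<integral>\<^sup>+ x \<in> A - {0}. ennreal (p t x) \<partial>lborel)"
    and p_radial: "\<And>t. t > 0 \<Longrightarrow> radial_nonincreasing (p t)"
    and l_sv: "slowly_varying_at_top l"
    and psi_deHaan: "de_Haan_class l \<Psi>"
  shows "\<forall>ts :: nat \<Rightarrow> real. \<forall>xs :: nat \<Rightarrow> 'a.
      (\<forall>n. ts n > 0) \<longrightarrow> (\<forall>n. xs n \<noteq> 0) \<longrightarrow> xs \<longlonglongrightarrow> 0 \<longrightarrow>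
      (\<lambda>n. ts n * \<Psi> (1 / norm (xs n))) \<longlonglongrightarrow> 0 \<longrightarrow>
      (\<lambda>n. p (ts n) (xs n) /
            (ts n * norm (xs n) powr (- real DIM('a)) * l (1 / norm (xs n))))
        \<longlonglongrightarrow> Gamma (real DIM('a) / 2) / (2 * pi powr (real DIM('a) / 2))"
proof (intro allI impI)
  fix ts :: "nat \<Rightarrow> real" and xs :: "nat \<Rightarrow> 'a"
  assume ts: "\<forall>n. ts n > 0" and xs: "\<forall>n. xs n \<noteq> 0" and xs0: "xs \<longlonglongrightarrow> 0"
    and lim: "(\<lambda>n. ts n * \<Psi> (1 / norm (xs n))) \<longlonglongrightarrow> 0"
  define C where "C = 1 / (real DIM('a) * unit_ball_vol (real DIM('a)))"
  have C: "C > 0" by (simp add: C_def)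
  \<comment> \<open>The unit ball has volume \<open>pi^(d/2) / Gamma (d/2 + 1)\<close>; the
    functional equation of \<open>Gamma\<close> turns \<open>d\<close> times this volume into the
    sphere area \<open>2 pi^(d/2) / Gamma (d/2)\<close>.\<close>
  have C_eq: "Gamma (real DIM('a) / 2) / (2 * pi powr (real DIM('a) / 2)) = C"
  proof -
    have "Gamma (real DIM('a) / 2 + 1) = real DIM('a) / 2 * Gamma (real DIM('a) / 2)"
      by (rule Gamma_plus1) (auto dest: nonpos_Ints_nonpos)
    then show ?thesis unfolding C_def unit_ball_vol_def by (simp only:) simp
  qed
  define x where "x n = 1 / norm (xs n)" for n
  have x_pos: "x n > 0" for n using xs by (simp add: x_def)
  have x_top: "filterlim x at_top sequentially"
  proof -
    have "filterlim (\<lambda>n. norm (xs n)) (at_right 0) sequentially"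
      using tendsto_norm_zero[OF xs0] xs by (auto simp: filterlim_at intro!: eventuallyI)
    from filterlim_compose[OF filterlim_inverse_at_top_right this] show ?thesis
      by (simp add: x_def[abs_def] inverse_eq_divide)
  qed
  obtain a0 where a0: "\<And>x. x \<ge> a0 \<Longrightarrow> l x > 0"
    using l_sv by (auto simp: slowly_varying_at_top_def)
  have lpos: "eventually (\<lambda>n. l (x n) > 0) sequentially"
    using x_top[unfolded filterlim_at_top, rule_format, of a0] by eventually_elim (rule a0)
  define q where "q n = p (ts n) (xs n) / (ts n * norm (xs n) powr (- real DIM('a)) * l (1 / norm (xs n)))" for n
  define I where "I \<alpha> \<beta> = (\<integral>y. annulus_bump \<alpha> \<beta> y \<partial>(lborel :: 'a measure))" for \<alpha> \<beta>
  define J where "J \<alpha> \<beta> n = (\<integral>y. annulus_bump \<alpha> \<beta> (x n *\<^sub>R y) \<partial>\<mu> (ts n)) / (ts n * l (x n))" for \<alpha> \<beta> n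
  define J' where "J' \<alpha> \<beta> = (\<integral>y. annulus_bump \<alpha> \<beta> y * norm y powr - real DIM('a) \<partial>(lborel :: 'a measure))" for \<alpha> \<beta>
  have J: "J \<alpha> \<beta> \<longlonglongrightarrow> C * J' \<alpha> \<beta>" for \<alpha> \<beta>
  proof -
    have "(\<lambda>n. ts n * \<Psi> (x n)) \<longlonglongrightarrow> 0" using lim by (simp add: x_def)
    from gaussian_test_tendsto[OF mu_prob mu_sets mu_char l_sv psi_deHaan ts[rule_format] x_top this continuous_bump]
    show ?thesis unfolding J_def[abs_def] J'_def C_def annulus_bump_def gauss_kernel_def by simp
  qed
  \<comment> \<open>Dilation by \<open>x n\<close> contributes \<open>norm (xs n) ^ d\<close> to the
    Lebesgue integral, which is precisely the factor \<open>|x|^(-d)\<close> of the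
    normalisation.\<close>
  have qeq: "q n * I \<alpha> \<beta> = p (ts n) (xs n) * (\<integral>y. annulus_bump \<alpha> \<beta> (x n *\<^sub>R y) \<partial>(lborel :: 'a measure)) / (ts n * l (x n))" for n \<alpha> \<beta>
  proof -
    have "norm (xs n) powr (- real DIM('a)) = 1 / norm (xs n) ^ DIM('a)"
      using xs by (simp add: powr_minus powr_realpow divide_inverse)
    then show ?thesis
      using x_pos[of n] by (simp add: q_def I_def integral_annulus_bump_scale x_def)
  qed
  have int: "integrable (\<mu> (ts n)) (\<lambda>y. annulus_bump \<alpha> \<beta> (x n *\<^sub>R y))" for n \<alpha> \<beta>
  proof -
    interpret M: prob_space "\<mu> (ts n)" using mu_prob ts by simp
    note [measurable_cong] = mu_sets[OF ts[rule_format, of n]]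
    show ?thesis
      by (rule M.integrable_const_bound[of _ 1]) (auto simp: annulus_bump_nonneg annulus_bump_le_1)
  qed
  note bounds = radial_density_integral_bounds[OF mu_sets p_radial p_nonneg _ p_density integrable_annulus_bump int]
  \<comment> \<open>Outer radius 1 in the scaled variable is the sphere through \<open>xs n\<close>,
    so the support lies inside it, where the density is at least
    \<open>p (ts n) (xs n)\<close>.\<close>
  have up: "q n * I \<alpha> 1 \<le> J \<alpha> 1 n" if "l (x n) > 0" "0 < \<alpha>" "\<alpha> < 1" for n \<alpha>
  proof -
    have "p (ts n) (xs n) * (\<integral>y. annulus_bump \<alpha> 1 (x n *\<^sub>R y) \<partial>(lborel :: 'a measure)) \<le> (\<integral>y. annulus_bump \<alpha> 1 (x n *\<^sub>R y) \<partial>\<mu> (ts n))"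
    proof (rule bounds(1))
      show "norm y \<le> norm (xs n)" if "annulus_bump \<alpha> 1 (x n *\<^sub>R y) \<noteq> 0" for y
        using that \<open>0 < \<alpha>\<close> \<open>\<alpha> < 1\<close> xs by (simp add: annulus_bump_nonzero_iff x_def field_simps)
      show "annulus_bump \<alpha> 1 (x n *\<^sub>R (0::'a)) = 0"
        using annulus_bump_nonzero_iff[of \<alpha> 1 "0::'a"] that by simp
    qed (use ts xs that x_pos annulus_bump_nonneg in auto)
    then show ?thesis unfolding qeq J_def using that ts by (intro divide_right_mono) (auto simp: less_imp_le)
  qed
  have lo: "J 1 \<beta> n \<le> q n * I 1 \<beta>" if "l (x n) > 0" "1 < \<beta>" for n \<beta>
  proof -
    have "(\<integral>y. annulus_bump 1 \<beta> (x n *\<^sub>R y) \<partial>\<mu> (ts n)) \<le> p (ts n) (xs n) * (\<integral>y. annulus_bump 1 \<beta> (x n *\<^sub>R y) \<partial>(lborel :: 'a measure))"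
    proof (rule bounds(2))
      show "norm (xs n) \<le> norm y" if "annulus_bump 1 \<beta> (x n *\<^sub>R y) \<noteq> 0" for y
        using that \<open>1 < \<beta>\<close> xs by (simp add: annulus_bump_nonzero_iff x_def field_simps)
      show "annulus_bump 1 \<beta> (x n *\<^sub>R (0::'a)) = 0"
        using annulus_bump_nonzero_iff[of 1 \<beta> "0::'a"] that by simp
    qed (use ts xs that x_pos annulus_bump_nonneg in auto)
    then show ?thesis unfolding qeq J_def using that ts by (intro divide_right_mono) (auto simp: less_imp_le)
  qed
  \<comment> \<open>The arbitrary \<open>S\<close> lets the same limit serve from the left and from
    the right of 1.\<close>
  have cont: "((\<lambda>\<gamma>. C * \<gamma> powr - real DIM('a)) \<longlongrightarrow> C * 1 powr - real DIM('a)) (at 1 within S)" for S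
    by (intro tendsto_intros) auto
  have "q \<longlonglongrightarrow> C"
  proof (rule order_tendstoI)
    \<comment> \<open>The limit superior of \<open>q\<close> is at most
      \<open>C * J' \<alpha> 1 / I \<alpha> 1\<close>, hence at most
      \<open>C * \<alpha> powr - d\<close>, for each \<alpha> in (0,1). One \<alpha> close enough to
      1 puts this below \<open>a\<close>, so the annulus is fixed before \<open>n\<close> tends to
      infinity.\<close>
    fix a assume "C < a"
    then have "eventually (\<lambda>\<gamma>. C * \<gamma> powr - real DIM('a) < a) (at_left 1)"
      using order_tendstoD(2)[OF cont] by simp
    moreover have "eventually (\<lambda>\<gamma>::real. \<gamma> \<in> {0<..<1}) (at_left 1)"
      by (rule eventually_at_leftI[of 0]) auto
    ultimately have "eventually (\<lambda>\<gamma>. C * \<gamma> powr - real DIM('a) < a \<and> \<gamma> \<in> {0<..<1}) (at_left 1)"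
      by (rule eventually_conj)
    then obtain \<alpha> where \<alpha>: "C * \<alpha> powr - real DIM('a) < a" "0 < \<alpha>" "\<alpha> < 1"
      using eventually_happens'[of "at_left (1::real)"] by (auto simp: trivial_limit_at_left_real)
    have I: "I \<alpha> 1 > 0" unfolding I_def using \<alpha> by (intro integral_annulus_bump_pos) auto
    have "C * J' \<alpha> 1 \<le> C * (\<alpha> powr - real DIM('a) * I \<alpha> 1)"
      unfolding J'_def I_def using \<alpha> C by (intro mult_left_mono integral_annulus_bump_powr_bounds) auto
    also have "\<dots> < a * I \<alpha> 1" using \<alpha> I by simp
    finally have "eventually (\<lambda>n. J \<alpha> 1 n < a * I \<alpha> 1) sequentially"
      by (rule order_tendstoD(2)[OF J])
    with lpos show "eventually (\<lambda>n. q n < a) sequentially"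
    proof eventually_elim
      case (elim n)
      then have "q n * I \<alpha> 1 < a * I \<alpha> 1" using up[of n \<alpha>] \<alpha> by linarith
      then show ?case using I by simp
    qed
  next
    fix a assume "a < C"
    then have "eventually (\<lambda>\<gamma>. a < C * \<gamma> powr - real DIM('a)) (at_right 1)"
      using order_tendstoD(1)[OF cont] by simp
    moreover have "eventually (\<lambda>\<gamma>::real. \<gamma> \<in> {1<..<2}) (at_right 1)"
      by (rule eventually_at_rightI[of _ 2]) auto
    ultimately have "eventually (\<lambda>\<gamma>. a < C * \<gamma> powr - real DIM('a) \<and> \<gamma> \<in> {1<..<2}) (at_right 1)"
      by (rule eventually_conj)
    then obtain \<beta> where \<beta>: "a < C * \<beta> powr - real DIM('a)" "1 < \<beta>"
      using eventually_happens'[of "at_right (1::real)"] by (auto simp: trivial_limit_at_right_real)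
    have I: "I 1 \<beta> > 0" unfolding I_def using \<beta> by (intro integral_annulus_bump_pos) auto
    have "a * I 1 \<beta> < C * (\<beta> powr - real DIM('a) * I 1 \<beta>)" using \<beta> I by simp
    also have "\<dots> \<le> C * J' 1 \<beta>"
      unfolding J'_def I_def using \<beta> C by (intro mult_left_mono integral_annulus_bump_powr_bounds) auto
    finally have "eventually (\<lambda>n. a * I 1 \<beta> < J 1 \<beta> n) sequentially"
      by (rule order_tendstoD(1)[OF J])
    with lpos show "eventually (\<lambda>n. a < q n) sequentially"
    proof eventually_elim
      case (elim n)
      then have "a * I 1 \<beta> < q n * I 1 \<beta>" using lo[of n \<beta>] \<beta> by linarith
      then show ?case using I by simp
    qed
  qed
  then show "(\<lambda>n. p (ts n) (xs n) / (ts n * norm (xs n) powr (- real DIM('a)) * l (1 / norm (xs n))))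
        \<longlonglongrightarrow> Gamma (real DIM('a) / 2) / (2 * pi powr (real DIM('a) / 2))"
    unfolding C_eq q_def[abs_def] .
qed

end
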